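(* For each integer $n\ge 2$ let $K_n^t$ be the $t$-step transition kernel of the Gibbs sampler on the simplex $\Delta_n$ (defined in the context), and let $U_n$ be the uniform probability distribution on $\Delta_n$. (1) Fix a real number $C>3$ and an integer $n$ satisfying $n>\max\left(4096,\,2C+\tfrac72\right)$ and $$\frac{n}{\log n}>\frac{3\left(\tfrac12+C\right)C}{\tfrac C2-\tfrac14}.$$ Then for all integers $t>10\,C\,n\log n$, all $x\in\Delta_n$ and all measurable $A\subset\Delta_n$, $$\left|K_n^t(x,A)-U_n(A)\right|<n^{3-C}+2\,n^{-\frac C2+\frac14}+4\,n^{\frac{11}{4}-C}.$$ (2) Let $0<C<1$, and for each $n$ let $t=t_n$ be a nonnegative integer with $t_n<(1-C)\,n\log n$. Then $$\liminf_{n\to\infty}\ \sup_{x\in\Delta_n}\ \sup_{A\subset\Delta_n}\left|K_n^{t_n}(x,A)-U_n(A)\right|=1,$$ where the inner supremum is over measurable $A\subset\Delta_n$.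
   Context: $\Delta_n=\{X\in\mathbb{R}^n:\ \sum_{i=1}^n X[i]=1,\ X[i]\ge 0 \text{ for all } i\}$, where $X[i]$ denotes the $i$th coordinate of $X$. The Gibbs sampler on $\Delta_n$ is the following Markov chain $(X_t)_{t\ge0}$. Given $X_t\in\Delta_n$, choose a pair $1\le i<j\le n$ uniformly at random and, independently, $\lambda$ uniformly in $[0,1]$ (both independent of the past), and set $$X_{t+1}[i]=\lambda(X_t[i]+X_t[j]),\quad X_{t+1}[j]=(1-\lambda)(X_t[i]+X_t[j]),\quad X_{t+1}[k]=X_t[k]\ \ (k\ne i,j).$$ $K_n$ is its transition kernel and $K_n^t(x,A)=P[X_t\in A\mid X_0=x]$. The logarithm is the natural logarithm. *)

theory Defs
  imports "HOL-Probability.Probability"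
begin

text \<open>
  The dimension varies inside the statement, so a point of \<open>n\<close>-space is an extensional function
  on the index set \<open>{1..n}\<close>, i.e. an element of the space of \<open>\<Pi>\<^sub>M i\<in>{1..n}. borel\<close>.
\<close>

definition prob_simplex :: "nat \<Rightarrow> (nat \<Rightarrow> real) set" where
  "prob_simplex n = {x \<in> extensional {1..n}. (\<Sum>i\<in>{1..n}. x i) = 1 \<and> (\<forall>i\<in>{1..n}. 0 \<le> x i)}"

definition simplex_space :: "nat \<Rightarrow> (nat \<Rightarrow> real) measure" where
  "simplex_space n = restrict_space (\<Pi>\<^sub>M i\<in>{1..n}. borel) (prob_simplex n)"

text \<open>
  \<^const>\<open>uniform_measure\<close> keeps the space of \<open>M\<close>. Here the space is restricted to \<open>S\<close>, because
  the maps pushed forward below send only points of \<open>S\<close> into the simplex.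
\<close>

definition uniform_on :: "'a measure \<Rightarrow> 'a set \<Rightarrow> 'a measure" where
  "uniform_on M S = uniform_measure (restrict_space M S) S"

text \<open>
  The uniform distribution on the simplex is normalised \<open>(n-1)\<close>-dimensional Lebesgue measure.
  The simplex is the graph of the affine function \<open>y \<mapsto> 1 - (\<Sum>i<n. y i)\<close> over the solid corner
  below; as the map onto the graph is affine, its Jacobian is constant and cancels in the
  normalisation.
\<close>

definition corner :: "nat \<Rightarrow> (nat \<Rightarrow> real) set" where
  "corner n = {y \<in> extensional {1..<n}. (\<Sum>i\<in>{1..<n}. y i) \<le> 1 \<and> (\<forall>i\<in>{1..<n}. 0 \<le> y i)}"

definition simplex_uniform :: "nat \<Rightarrow> (nat \<Rightarrow> real) measure" where
  "simplex_uniform n =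
     distr (uniform_on (\<Pi>\<^sub>M i\<in>{1..<n}. lborel) (corner n)) (simplex_space n)
       (\<lambda>y. y(n := 1 - (\<Sum>i\<in>{1..<n}. y i)))"

definition gibbs_update :: "nat \<Rightarrow> nat \<Rightarrow> real \<Rightarrow> (nat \<Rightarrow> real) \<Rightarrow> (nat \<Rightarrow> real)" where
  "gibbs_update i j l x = x(i := l * (x i + x j), j := (1 - l) * (x i + x j))"

definition index_pairs :: "nat \<Rightarrow> (nat \<times> nat) set" where
  "index_pairs n = {(i, j). 1 \<le> i \<and> i < j \<and> j \<le> n}"

definition gibbs_kernel :: "nat \<Rightarrow> (nat \<Rightarrow> real) \<Rightarrow> (nat \<Rightarrow> real) measure" where
  "gibbs_kernel n x =
     distr (uniform_count_measure (index_pairs n) \<Otimes>\<^sub>M uniform_on lborel {0..1})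
       (simplex_space n) (\<lambda>((i, j), l). gibbs_update i j l x)"

text \<open>The law of \<open>X\<^sub>t\<close> given \<open>X\<^sub>0 = x\<close>; the Giry bind integrates \<open>gibbs_kernel n\<close> against
  the law of the current state.\<close>

primrec gibbs_kernel_pow :: "nat \<Rightarrow> nat \<Rightarrow> (nat \<Rightarrow> real) \<Rightarrow> (nat \<Rightarrow> real) measure" where
  "gibbs_kernel_pow n 0 x = return (simplex_space n) x"
| "gibbs_kernel_pow n (Suc t) x = gibbs_kernel_pow n t x \<bind> gibbs_kernel n"

text \<open>Both \<^const>\<open>distr\<close> and \<^const>\<open>bind\<close> are total and give unspecified values for
  non-measurable arguments. The lemmas below exclude this for \<open>n \<ge> 2\<close>.\<close>

lemma space_simplex_space [simp]: "space (simplex_space n) = prob_simplex n"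
  by (auto simp: simplex_space_def space_restrict_space space_PiM prob_simplex_def PiE_def)

lemma finite_index_pairs: "finite (index_pairs n)"
  by (rule finite_subset[of _ "{1..n} \<times> {1..n}"]) (auto simp: index_pairs_def)

lemma index_pairs_nonempty:
  assumes "n \<ge> 2"
  shows "index_pairs n \<noteq> {}"
proof -
  have "(1, 2) \<in> index_pairs n" using assms by (simp add: index_pairs_def)
  then show ?thesis by blast
qed

lemma gibbs_update_in_simplex:
  assumes x: "x \<in> prob_simplex n" and ij: "(i, j) \<in> index_pairs n" and l: "0 \<le> l" "l \<le> 1"
  shows "gibbs_update i j l x \<in> prob_simplex n"
proof -
  let ?I = "{1..n} - {i} - {j}"
  have mem: "i \<in> {1..n}" "j \<in> {1..n} - {i}"
    using ij by (auto simp: index_pairs_def)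
  have split: "sum f {1..n} = f i + (f j + sum f ?I)" for f :: "nat \<Rightarrow> real"
    using mem by (subst sum.remove[of _ i], simp, simp, subst sum.remove[of _ j]) auto
  have "sum (gibbs_update i j l x) ?I = sum x ?I"
    by (rule sum.cong) (auto simp: gibbs_update_def)
  then have "sum (gibbs_update i j l x) {1..n} = sum x {1..n}"
    unfolding split using mem by (simp add: gibbs_update_def algebra_simps)
  then show ?thesis
    using x mem l by (auto simp: prob_simplex_def gibbs_update_def extensional_def)
qed

lemma uniform_on_interval: "prob_space (uniform_on lborel {0..1::real})"
  unfolding uniform_on_def
  by (rule prob_space_uniform_measure) (auto simp: emeasure_restrict_space)

lemma space_uniform_on: "S \<subseteq> space M \<Longrightarrow> space (uniform_on M S) = S"
  by (auto simp: uniform_on_def space_restrict_space)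

lemma sets_uniform_on [measurable_cong]: "sets (uniform_on M S) = sets (restrict_space M S)"
  by (simp add: uniform_on_def)

lemma measurable_gibbs_update:
  "(\<lambda>(x, (i, j), l). gibbs_update i j l x)
     \<in> simplex_space n \<Otimes>\<^sub>M (uniform_count_measure (index_pairs n) \<Otimes>\<^sub>M uniform_on lborel {0..1})
       \<rightarrow>\<^sub>M simplex_space n"
proof -
  let ?C = "count_space (index_pairs n)" and ?U = "uniform_on lborel {0..1::real}"
  let ?P = "\<Pi>\<^sub>M i\<in>{1..n}. (borel :: real measure)"
  let ?f = "\<lambda>(x, (p :: nat \<times> nat), l). gibbs_update (fst p) (snd p) l x"
  have U: "(\<lambda>l. l) \<in> ?U \<rightarrow>\<^sub>M borel"
    using measurable_restrict_space1[of "\<lambda>l. l" lborel borel "{0..1}"]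
    by (simp add: uniform_on_def cong: measurable_cong_sets)
  have X: "(\<lambda>x. x) \<in> simplex_space n \<rightarrow>\<^sub>M ?P"
    unfolding simplex_space_def by (rule measurable_restrict_space1) simp
  have fix_pair: "(\<lambda>w. gibbs_update i j (snd w) (fst w)) \<in> simplex_space n \<Otimes>\<^sub>M ?U \<rightarrow>\<^sub>M ?P"
    if ij: "(i, j) \<in> index_pairs n" for i j
  proof (rule measurable_PiM_single')
    have X': "fst \<in> simplex_space n \<Otimes>\<^sub>M ?U \<rightarrow>\<^sub>M ?P"
      by (rule measurable_compose[OF measurable_fst X])
    have U': "snd \<in> simplex_space n \<Otimes>\<^sub>M ?U \<rightarrow>\<^sub>M borel"
      by (rule measurable_compose[OF measurable_snd U])
    have comp: "(\<lambda>w. fst w k) \<in> borel_measurable (simplex_space n \<Otimes>\<^sub>M ?U)" if "k \<in> {1..n}" for k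
      using measurable_compose[OF X' measurable_component_singleton[OF that]] by simp
    have mem: "i \<in> {1..n}" "j \<in> {1..n}"
      using ij by (auto simp: index_pairs_def)
    note [measurable] = comp[OF mem(1)] comp[OF mem(2)] U'
    show "(\<lambda>w. gibbs_update i j (snd w) (fst w) k) \<in> simplex_space n \<Otimes>\<^sub>M ?U \<rightarrow>\<^sub>M borel"
      if "k \<in> {1..n}" for k
    proof -
      note [measurable] = comp[OF that]
      consider "k = j" | "k = i" "k \<noteq> j" | "k \<noteq> i" "k \<noteq> j" by blast
      then show ?thesis
        by cases (simp_all add: gibbs_update_def)
    qed
    show "(\<lambda>w. gibbs_update i j (snd w) (fst w)) \<in>
        space (simplex_space n \<Otimes>\<^sub>M ?U) \<rightarrow> {1..n} \<rightarrow>\<^sub>E space borel"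
      using mem by (auto simp: space_pair_measure prob_simplex_def gibbs_update_def extensional_def PiE_def)
  qed
  have "?f \<in> simplex_space n \<Otimes>\<^sub>M (?C \<Otimes>\<^sub>M ?U) \<rightarrow>\<^sub>M ?P"
  proof -
    have swap: "(\<lambda>w. (fst (snd w), (fst w, snd (snd w))))
        \<in> simplex_space n \<Otimes>\<^sub>M (?C \<Otimes>\<^sub>M ?U) \<rightarrow>\<^sub>M ?C \<Otimes>\<^sub>M (simplex_space n \<Otimes>\<^sub>M ?U)"
      by measurable
    have "(\<lambda>(p, w). gibbs_update (fst p) (snd p) (snd w) (fst w))
        \<in> ?C \<Otimes>\<^sub>M (simplex_space n \<Otimes>\<^sub>M ?U) \<rightarrow>\<^sub>M ?P"
      using fix_pair
      by (intro measurable_pair_measure_countable1 countable_finite finite_index_pairs) auto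
    from measurable_compose[OF swap this] show ?thesis
      by (simp add: case_prod_beta')
  qed
  moreover have "?f \<in> space (simplex_space n \<Otimes>\<^sub>M (?C \<Otimes>\<^sub>M ?U)) \<rightarrow> prob_simplex n"
    by (auto simp: space_pair_measure space_uniform_on intro!: gibbs_update_in_simplex)
  ultimately have "?f \<in> simplex_space n \<Otimes>\<^sub>M (?C \<Otimes>\<^sub>M ?U) \<rightarrow>\<^sub>M restrict_space ?P (prob_simplex n)"
    by (intro measurable_restrict_space2) auto
  moreover have "sets (simplex_space n \<Otimes>\<^sub>M (uniform_count_measure (index_pairs n) \<Otimes>\<^sub>M ?U)) =
      sets (simplex_space n \<Otimes>\<^sub>M (?C \<Otimes>\<^sub>M ?U))"
    by (intro sets_pair_measure_cong) (auto simp: sets_uniform_count_measure)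
  ultimately show ?thesis
    unfolding simplex_space_def[symmetric] by (simp add: case_prod_beta' cong: measurable_cong_sets)
qed

lemma gibbs_kernel_measurable:
  assumes "n \<ge> 2"
  shows "gibbs_kernel n \<in> simplex_space n \<rightarrow>\<^sub>M prob_algebra (simplex_space n)"
proof -
  let ?N = "uniform_count_measure (index_pairs n) \<Otimes>\<^sub>M uniform_on lborel {0..1::real}"
  interpret U: prob_space "uniform_on lborel {0..1::real}" by (rule uniform_on_interval)
  interpret C: prob_space "uniform_count_measure (index_pairs n)"
    by (rule prob_space_uniform_count_measure[OF finite_index_pairs index_pairs_nonempty[OF assms]])
  interpret pair_prob_space "uniform_count_measure (index_pairs n)" "uniform_on lborel {0..1::real}" ..
  have "?N \<in> space (prob_algebra ?N)"
    by (simp add: space_prob_algebra prob_space_axioms)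
  then have "(\<lambda>_. ?N) \<in> simplex_space n \<rightarrow>\<^sub>M prob_algebra ?N"
    by (rule measurable_const)
  from measurable_distr_prob_space2[OF this, of "\<lambda>x ((i, j), l). gibbs_update i j l x"]
  show ?thesis
    using measurable_gibbs_update[of n] unfolding gibbs_kernel_def by (simp add: case_prod_beta')
qed

lemma gibbs_kernel_pow_measurable:
  assumes "n \<ge> 2"
  shows "gibbs_kernel_pow n t \<in> simplex_space n \<rightarrow>\<^sub>M prob_algebra (simplex_space n)"
proof (induction t)
  case 0
  have "gibbs_kernel_pow n 0 = return (simplex_space n)" by (auto simp: fun_eq_iff)
  then show ?case by simp
next
  case (Suc t)
  have "gibbs_kernel_pow n (Suc t) = (\<lambda>x. gibbs_kernel_pow n t x \<bind> gibbs_kernel n)"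
    by (auto simp: fun_eq_iff)
  then show ?case
    using measurable_bind_prob_space[OF Suc gibbs_kernel_measurable[OF assms]] by simp
qed

lemma prob_space_simplex_uniform:
  assumes "n \<ge> 1"
  shows "prob_space (simplex_uniform n)"
proof -
  let ?L = "\<Pi>\<^sub>M i\<in>{1..<n}. (lborel :: real measure)"
  let ?B = "\<Pi>\<^sub>M i\<in>{1..n}. (borel :: real measure)"
  let ?g = "\<lambda>y. y(n := 1 - (\<Sum>i\<in>{1..<n}. y i :: real))"
  have corner: "corner n = {x. (\<forall>i\<in>{1..<n}. 0 \<le> x i) \<and> sum x {1..<n} \<le> 1} \<inter> space ?L"
    by (auto simp: corner_def space_PiM PiE_def)
  have em: "emeasure ?L (corner n) = ennreal (1 / fact (n - 1))"
    unfolding corner using emeasure_std_simplex_aux[of "{1..<n}" 1] by simp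
  have "corner n \<in> sets ?L"
    using em by (intro emeasure_neq_0_sets) simp
  then have r: "emeasure (restrict_space ?L (corner n)) (corner n) = ennreal (1 / fact (n - 1))"
    using em by (subst emeasure_restrict_space) (auto simp: corner)
  then have P: "prob_space (uniform_on ?L (corner n))"
    unfolding uniform_on_def by (intro prob_space_uniform_measure) simp_all
  have "?g \<in> ?L \<rightarrow>\<^sub>M ?B"
  proof (rule measurable_PiM_single')
    show "(\<lambda>y. ?g y k) \<in> ?L \<rightarrow>\<^sub>M borel" if "k \<in> {1..n}" for k
    proof (cases "k = n")
      case False
      then have "k \<in> {1..<n}" using that by auto
      then have "(\<lambda>y. y k) \<in> ?L \<rightarrow>\<^sub>M borel"
        using measurable_component_singleton[of k "{1..<n}" "\<lambda>_. lborel :: real measure"] by simp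
      with False show ?thesis by simp
    qed simp
    show "?g \<in> space ?L \<rightarrow> {1..n} \<rightarrow>\<^sub>E space borel"
      using assms by (auto simp: space_PiM PiE_def extensional_def)
  qed
  moreover have "?g y \<in> prob_simplex n" if "y \<in> corner n" for y
  proof -
    have "{1..n} = insert n {1..<n}" using assms by auto
    then have "sum (?g y) {1..n} = 1" by (simp add: sum.insert)
    then show ?thesis using that assms by (auto simp: corner_def prob_simplex_def extensional_def)
  qed
  ultimately have "?g \<in> restrict_space ?L (corner n) \<rightarrow>\<^sub>M simplex_space n"
    unfolding simplex_space_def
    by (intro measurable_restrict_space2 measurable_restrict_space1)
       (auto simp: space_restrict_space)
  then have "?g \<in> uniform_on ?L (corner n) \<rightarrow>\<^sub>M simplex_space n"
    by (simp add: uniform_on_def)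
  with P show ?thesis
    unfolding simplex_uniform_def by (rule prob_space.prob_space_distr)
qed

end

theory Submission
  imports Defs
begin

text \<open>
  \<^bold>\<open>Upper bound.\<close> Compare the chain started at \<open>x\<close> with a copy \<open>y\<close> that starts from the
  uniform distribution, which is invariant. The \<open>t\<close> steps are divided into two phases.

  During the first phase both copies use the same pair and the same \<open>\<lambda>\<close>. The mean squared
  distance contracts by the factor \<open>1 - 2 / (3 n)\<close> in each step (\<open>sq_dist_contraction\<close>), so
  after about \<open>9 C n ln n\<close> steps the copies are polynomially close.

  The second phase, of about \<open>C n ln n\<close> steps, is coupled with knowledge of its whole sequence
  of pairs. Regard the pairs from some time onwards as the edges of a graph on the
  coordinates. As time advances edges are lost, and the connected components split, ending
  with singletons. Suppose that the current pair \<open>(i, j)\<close> joins two different components of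
  the graph of the later pairs. The masses of these two components are final after this step,
  because no later pair moves mass out of them. So \<open>\<lambda>\<close> is coupled at this step such that both
  components receive the same mass in the two copies; at all other steps the copies use the
  same \<open>\<lambda>\<close>. If the graph of the whole second phase is connected, then the copies have equal
  mass on the only component at its beginning, equal masses on all components at all later
  times, and at the end they agree in every coordinate (\<open>fixed_sequence_coupling\<close>).

  A splitting step couples a uniform variable on an interval of length \<open>x i + x j\<close> with one on
  a shifted interval of length \<open>y i + y j\<close>. It fails with probability at most
  \<open>e / (y i + y j)\<close> (\<open>shifted_uniform_comparison\<close>), where \<open>e\<close> bounds the \<open>L1\<close>-distance of the
  copies on the component. This distance never increases: each of the two parts inherits the
  bound of the component that splits (\<open>aligned_update_split\<close>). Since \<open>y\<close> is stationary, the
  mean of \<open>1 / (y i + y j)\<close> is at most \<open>n - 1\<close> (\<open>nn_integral_inverse_pair_sum\<close>). Finally, the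
  random pairs are connected up to a probability of order \<open>n powr (1 - C)\<close>, by a union bound
  over the sets that no pair crosses (\<open>avg_seq_disconnected\<close>). All errors together are less
  than \<open>n powr (3 - C)\<close>.

  The couplings appear as pointwise inequalities \<open>g y \<le> g x + cost\<close> between values of the
  averaged test function, which are propagated through single steps; this is where the form of
  the lemmas comes from.

  \<^bold>\<open>Lower bound.\<close> Start at a vertex. The number \<open>k\<close> of nonzero coordinates grows by at most
  one per step, and only if the pair contains exactly one nonzero coordinate, that is with
  probability at most \<open>2 k (n - k) / (n (n - 1))\<close>. The mean of \<open>k / (n + 1 - k)\<close> grows at most
  by the factor \<open>1 + 2 (n + 1) / (n (n - 1))\<close> per step (\<open>gibbs_op_support_odds\<close>), and has to
  rise from \<open>1 / n\<close> to \<open>n\<close>. Before time \<open>(1 - C) n ln n\<close>, for large \<open>n\<close>, some coordinate is therefore still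
  zero with probability at least \<open>1 - n powr (- 2 * C\<^sup>2)\<close>, an event of probability zero under
  the uniform distribution.
\<close>


section \<open>The transition kernel as an averaging operator\<close>

lemma nn_integral_uniform_on:
  assumes S: "S \<in> sets M" and f: "f \<in> borel_measurable (restrict_space M S)"
  shows "(\<integral>\<^sup>+ x. f x \<partial>uniform_on M S) = (\<integral>\<^sup>+ x. f x * indicator S x \<partial>M) / emeasure M S"
proof -
  have S': "S \<inter> space M \<in> sets M" "S \<inter> space M = S"
    using S sets.sets_into_space[OF S] by (auto simp: Int_absorb2)
  have "S \<in> sets (restrict_space M S)"
    using S by (simp add: sets_restrict_space_iff S')
  then have "(\<integral>\<^sup>+ x. f x \<partial>uniform_on M S)
      = (\<integral>\<^sup>+ x. f x * indicator S x \<partial>restrict_space M S) / emeasure (restrict_space M S) S"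
    unfolding uniform_on_def by (rule nn_integral_uniform_measure[OF f])
  also have "\<dots> = (\<integral>\<^sup>+ x. f x * indicator S x \<partial>M) / emeasure M S"
    using S' by (simp add: nn_integral_restrict_space emeasure_restrict_space mult.assoc
        flip: indicator_inter_arith)
  finally show ?thesis .
qed

abbreviation unit_law :: "real measure" where
  "unit_law \<equiv> uniform_on lborel {0..1}"

abbreviation pair_law :: "nat \<Rightarrow> (nat \<times> nat) measure" where
  "pair_law n \<equiv> uniform_count_measure (index_pairs n)"

lemma space_unit_law [simp]: "space unit_law = {0..1}"
  by (simp add: space_uniform_on)

lemma space_pair_law [simp]: "space (pair_law n) = index_pairs n"
  by (simp add: space_uniform_count_measure)

lemma measurable_pair_law [simp]: "f \<in> borel_measurable (pair_law n)"
  by (simp add: measurable_def sets_uniform_count_measure space_uniform_count_measure Pow_def)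

lemma nn_integral_pair_law:
  "(\<integral>\<^sup>+ p. f p \<partial>pair_law n) = (\<Sum>p\<in>index_pairs n. f p * ennreal (1 / card (index_pairs n)))"
  unfolding uniform_count_measure_def
  by (subst nn_integral_point_measure_finite) (auto simp: finite_index_pairs mult.commute)

lemma measurable_unit_law_iff:
  "measurable unit_law N = measurable (restrict_space lborel {0..1}) N"
  by (rule measurable_cong_sets[OF sets_uniform_on refl])

lemma borel_measurable_unit_law:
  "f \<in> borel_measurable borel \<Longrightarrow> f \<in> borel_measurable unit_law"
  unfolding measurable_unit_law_iff by (rule measurable_restrict_space1) simp

lemma nn_integral_unit_law:
  assumes "f \<in> borel_measurable unit_law"
  shows "(\<integral>\<^sup>+ l. f l \<partial>unit_law) = (\<integral>\<^sup>+ l. f l * indicator {0..1} l \<partial>lborel)"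
proof -
  have "f \<in> borel_measurable (restrict_space lborel {0..1})"
    using assms unfolding measurable_unit_law_iff .
  from nn_integral_uniform_on[OF _ this] show ?thesis
    by (simp add: divide_ennreal_def)
qed

text \<open>
  The one-step operator is split as an average over pairs of \<open>resample p\<close>, because the second
  phase of the coupling treats the sequence of pairs as fixed. All functions take values in
  \<^typ>\<open>ennreal\<close>: the costs below are infinite on a null set.
\<close>

definition resample :: "nat \<times> nat \<Rightarrow> ((nat \<Rightarrow> real) \<Rightarrow> ennreal) \<Rightarrow> (nat \<Rightarrow> real) \<Rightarrow> ennreal" where
  "resample p f x = (\<integral>\<^sup>+ l. f (gibbs_update (fst p) (snd p) l x) \<partial>unit_law)"

definition gibbs_op :: "nat \<Rightarrow> ((nat \<Rightarrow> real) \<Rightarrow> ennreal) \<Rightarrow> (nat \<Rightarrow> real) \<Rightarrow> ennreal" where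
  "gibbs_op n f x = (\<integral>\<^sup>+ p. resample p f x \<partial>pair_law n)"

abbreviation upd :: "nat \<times> nat \<Rightarrow> real \<Rightarrow> (nat \<Rightarrow> real) \<Rightarrow> (nat \<Rightarrow> real)" where
  "upd p l x \<equiv> gibbs_update (fst p) (snd p) l x"

lemma upd_in_simplex:
  "x \<in> prob_simplex n \<Longrightarrow> p \<in> index_pairs n \<Longrightarrow> l \<in> {0..1} \<Longrightarrow> upd p l x \<in> prob_simplex n"
  using gibbs_update_in_simplex[of x n "fst p" "snd p" l] by auto

lemma measurable_upd_joint:
  assumes p: "p \<in> index_pairs n"
  shows "(\<lambda>(x, l). upd p l x) \<in> simplex_space n \<Otimes>\<^sub>M unit_law \<rightarrow>\<^sub>M simplex_space n"
proof -
  have "(\<lambda>w. (fst w, (p, snd w))) \<in> simplex_space n \<Otimes>\<^sub>M unit_law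
      \<rightarrow>\<^sub>M simplex_space n \<Otimes>\<^sub>M (pair_law n \<Otimes>\<^sub>M unit_law)"
    using p by (intro measurable_Pair) auto
  from measurable_compose[OF this measurable_gibbs_update] show ?thesis
    by (simp add: case_prod_beta')
qed

lemma measurable_upd:
  assumes p: "p \<in> index_pairs n" and x: "x \<in> prob_simplex n"
  shows "(\<lambda>l. upd p l x) \<in> unit_law \<rightarrow>\<^sub>M simplex_space n"
  using measurable_compose[OF measurable_Pair1' measurable_upd_joint[OF p]] x
  by (simp add: case_prod_beta')

lemma measurable_comp_upd:
  "f \<in> borel_measurable (simplex_space n) \<Longrightarrow> p \<in> index_pairs n \<Longrightarrow> x \<in> prob_simplex n
    \<Longrightarrow> (\<lambda>l. f (upd p l x)) \<in> borel_measurable unit_law"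
  by (rule measurable_compose[OF measurable_upd])

lemma sigma_finite_unit_law: "sigma_finite_measure unit_law"
  by (rule prob_space_imp_sigma_finite[OF uniform_on_interval])

lemma measurable_resample:
  assumes f: "f \<in> borel_measurable (simplex_space n)" and p: "p \<in> index_pairs n"
  shows "resample p f \<in> borel_measurable (simplex_space n)"
proof -
  interpret sigma_finite_measure unit_law by (rule sigma_finite_unit_law)
  have "(\<lambda>(x, l). f (upd p l x)) \<in> borel_measurable (simplex_space n \<Otimes>\<^sub>M unit_law)"
    using measurable_compose[OF measurable_upd_joint[OF p] f] by (simp add: case_prod_beta')
  then show ?thesis
    unfolding resample_def by (rule borel_measurable_nn_integral)
qed

lemma measurable_gibbs_op:
  assumes f: "f \<in> borel_measurable (simplex_space n)"
  shows "gibbs_op n f \<in> borel_measurable (simplex_space n)"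
  unfolding gibbs_op_def nn_integral_pair_law
  by (intro borel_measurable_sum borel_measurable_times_ennreal measurable_resample f) auto

lemma measurable_gibbs_op_pow:
  "f \<in> borel_measurable (simplex_space n) \<Longrightarrow> (gibbs_op n ^^ t) f \<in> borel_measurable (simplex_space n)"
  by (induction t) (auto intro: measurable_gibbs_op)

lemma resample_mono:
  assumes "\<And>z. z \<in> prob_simplex n \<Longrightarrow> f z \<le> g z" "p \<in> index_pairs n" "x \<in> prob_simplex n"
  shows "resample p f x \<le> resample p g x"
  unfolding resample_def by (intro nn_integral_mono assms(1) upd_in_simplex assms(2,3)) simp

lemma gibbs_op_mono:
  assumes "\<And>z. z \<in> prob_simplex n \<Longrightarrow> f z \<le> g z" "x \<in> prob_simplex n"
  shows "gibbs_op n f x \<le> gibbs_op n g x"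
  unfolding gibbs_op_def by (intro nn_integral_mono resample_mono[of n f g] assms) simp_all

lemma gibbs_op_cong:
  assumes "\<And>z. z \<in> prob_simplex n \<Longrightarrow> f z = g z" "x \<in> prob_simplex n"
  shows "gibbs_op n f x = gibbs_op n g x"
  using gibbs_op_mono[of n f g x] gibbs_op_mono[of n g f x] assms by (auto intro!: antisym)

lemma resample_const [simp]: "resample p (\<lambda>_. c) x = c"
  using prob_space.emeasure_space_1[OF uniform_on_interval] by (simp add: resample_def)

lemma prob_space_pair_law: "n \<ge> 2 \<Longrightarrow> prob_space (pair_law n)"
  by (rule prob_space_uniform_count_measure[OF finite_index_pairs index_pairs_nonempty])

lemma nn_integral_pair_law_const: "n \<ge> 2 \<Longrightarrow> (\<integral>\<^sup>+ p. c \<partial>pair_law n) = c"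
  using prob_space.emeasure_space_1[OF prob_space_pair_law[of n]] by simp

lemma nn_integral_gibbs_kernel:
  assumes f: "f \<in> borel_measurable (simplex_space n)" and x: "x \<in> prob_simplex n"
  shows "(\<integral>\<^sup>+ z. f z \<partial>gibbs_kernel n x) = gibbs_op n f x"
proof -
  interpret sigma_finite_measure unit_law by (rule sigma_finite_unit_law)
  have m: "(\<lambda>(p, l). upd p l x) \<in> pair_law n \<Otimes>\<^sub>M unit_law \<rightarrow>\<^sub>M simplex_space n"
    using measurable_compose[OF measurable_Pair1' measurable_gibbs_update] x
    by (simp add: case_prod_beta')
  have "(\<integral>\<^sup>+ z. f z \<partial>gibbs_kernel n x) = (\<integral>\<^sup>+ w. f (upd (fst w) (snd w) x) \<partial>(pair_law n \<Otimes>\<^sub>M unit_law))"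
    unfolding gibbs_kernel_def using nn_integral_distr[OF m, of f] f
    by (simp add: case_prod_beta')
  also have "\<dots> = gibbs_op n f x"
    using measurable_compose[OF m f] unfolding gibbs_op_def resample_def
    by (subst nn_integral_fst[symmetric]) (simp_all add: case_prod_beta')
  finally show ?thesis .
qed

text \<open>
  The kernel appends its steps at the end, the operator power peels them off at the front;
  both orders agree since powers of one operator commute.
\<close>

lemma nn_integral_gibbs_kernel_pow:
  assumes n: "n \<ge> 2" and f: "f \<in> borel_measurable (simplex_space n)" and x: "x \<in> prob_simplex n"
  shows "(\<integral>\<^sup>+ z. f z \<partial>gibbs_kernel_pow n t x) = (gibbs_op n ^^ t) f x"
  using f
proof (induction t arbitrary: f)
  case 0
  then show ?case using x by (simp add: nn_integral_return)
next
  case (Suc t)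
  note M = measurable_space[OF gibbs_kernel_pow_measurable[OF n, of t], of x]
  have sets: "sets (gibbs_kernel_pow n t x) = sets (simplex_space n)"
    using M x by (simp add: space_prob_algebra)
  have space: "space (gibbs_kernel_pow n t x) = prob_simplex n"
    using sets_eq_imp_space_eq[OF sets] by simp
  have "(\<integral>\<^sup>+ z. f z \<partial>gibbs_kernel_pow n (Suc t) x) =
      (\<integral>\<^sup>+ y. \<integral>\<^sup>+ z. f z \<partial>gibbs_kernel n y \<partial>gibbs_kernel_pow n t x)"
    unfolding gibbs_kernel_pow.simps
  proof (rule nn_integral_bind[OF Suc.prems])
    show "gibbs_kernel n \<in> gibbs_kernel_pow n t x \<rightarrow>\<^sub>M subprob_algebra (simplex_space n)"
      using measurable_prob_algebraD[OF gibbs_kernel_measurable[OF n]]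
      unfolding measurable_cong_sets[OF sets refl] .
  qed
  also have "\<dots> = (\<integral>\<^sup>+ y. gibbs_op n f y \<partial>gibbs_kernel_pow n t x)"
    using Suc.prems space by (intro nn_integral_cong nn_integral_gibbs_kernel) auto
  also have "\<dots> = (gibbs_op n ^^ t) (gibbs_op n f) x"
    by (rule Suc.IH[OF measurable_gibbs_op[OF Suc.prems]])
  finally show ?case by (simp add: funpow_swap1)
qed

section \<open>The uniform distribution on the simplex\<close>

lemma measurable_simplex_coord:
  assumes "k \<in> {1..n}"
  shows "(\<lambda>x. x k) \<in> borel_measurable (simplex_space n)"
  unfolding simplex_space_def
  by (rule measurable_restrict_space1[OF measurable_component_singleton[OF assms]])

lemma measurable_into_simplex:
  assumes "\<And>k. k \<in> {1..n} \<Longrightarrow> (\<lambda>w. f w k) \<in> borel_measurable M"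
    and into: "f \<in> space M \<rightarrow> prob_simplex n"
  shows "f \<in> M \<rightarrow>\<^sub>M simplex_space n"
  unfolding simplex_space_def
proof (rule measurable_restrict_space2[OF into measurable_PiM_single'])
  show "f \<in> space M \<rightarrow> {1..n} \<rightarrow>\<^sub>E space borel"
    using into by (auto simp: prob_simplex_def PiE_def)
qed (use assms in auto)

definition graph_point :: "nat \<Rightarrow> (nat \<Rightarrow> real) \<Rightarrow> nat \<Rightarrow> real" where
  "graph_point n y = y(n := 1 - (\<Sum>i\<in>{1..<n}. y i))"

definition solid_corner :: "nat set \<Rightarrow> (nat \<Rightarrow> real) set" where
  "solid_corner J = {z \<in> extensional J. sum z J \<le> 1 \<and> (\<forall>i\<in>J. 0 \<le> z i)}"

lemma solid_corner_eq:
  "solid_corner J = {x. (\<forall>i\<in>J. 0 \<le> x i) \<and> sum x J \<le> 1} \<inter> space (\<Pi>\<^sub>M i\<in>J. lborel)"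
  by (auto simp: solid_corner_def space_PiM PiE_def)

lemma emeasure_solid_corner:
  "finite J \<Longrightarrow> emeasure (\<Pi>\<^sub>M i\<in>J. lborel) (solid_corner J) = ennreal (1 / fact (card J))"
  unfolding solid_corner_eq using emeasure_std_simplex_aux[of J 1] by simp

lemma sets_solid_corner: "finite J \<Longrightarrow> solid_corner J \<in> sets (\<Pi>\<^sub>M i\<in>J. lborel)"
  using emeasure_solid_corner[of J] by (intro emeasure_neq_0_sets) simp

lemma measurable_graph_point:
  assumes n: "n \<ge> 1"
  shows "graph_point n \<in> restrict_space (\<Pi>\<^sub>M i\<in>{1..<n}. lborel) (corner n) \<rightarrow>\<^sub>M simplex_space n"
proof (rule measurable_into_simplex)
  let ?L = "\<Pi>\<^sub>M i\<in>{1..<n}. (lborel :: real measure)"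
  have coord: "(\<lambda>y. y k) \<in> borel_measurable ?L" if "k \<in> {1..<n}" for k
    using measurable_component_singleton[OF that, of "\<lambda>_. lborel :: real measure"] by simp
  show "(\<lambda>y. graph_point n y k) \<in> borel_measurable (restrict_space ?L (corner n))"
    if "k \<in> {1..n}" for k
  proof (rule measurable_restrict_space1, cases "k = n")
    case True
    then show "(\<lambda>y. graph_point n y k) \<in> borel_measurable ?L"
      using coord by (simp add: graph_point_def)
  next
    case False
    then show "(\<lambda>y. graph_point n y k) \<in> borel_measurable ?L"
      using that coord[of k] by (simp add: graph_point_def)
  qed
  show "graph_point n \<in> space (restrict_space ?L (corner n)) \<rightarrow> prob_simplex n"
  proof
    fix y assume "y \<in> space (restrict_space ?L (corner n))"
    then have y: "y \<in> corner n" by (simp add: space_restrict_space)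
    have "{1..n} = insert n {1..<n}" using n by auto
    then have "sum (graph_point n y) {1..n} = 1" by (simp add: graph_point_def)
    then show "graph_point n y \<in> prob_simplex n"
      using y n by (auto simp: graph_point_def corner_def prob_simplex_def extensional_def)
  qed
qed

lemma nn_integral_simplex_uniform:
  assumes n: "n \<ge> 1" and F: "F \<in> borel_measurable (simplex_space n)"
  shows "(\<integral>\<^sup>+ x. F x \<partial>simplex_uniform n) =
    (\<integral>\<^sup>+ y. F (graph_point n y) * indicator (corner n) y \<partial>(\<Pi>\<^sub>M i\<in>{1..<n}. lborel)) * fact (n - 1)"
proof -
  let ?L = "\<Pi>\<^sub>M i\<in>{1..<n}. (lborel :: real measure)"
  have c: "corner n = solid_corner {1..<n}" by (simp add: corner_def solid_corner_def)
  have g: "graph_point n \<in> uniform_on ?L (corner n) \<rightarrow>\<^sub>M simplex_space n"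
    unfolding measurable_cong_sets[OF sets_uniform_on refl] by (rule measurable_graph_point[OF n])
  have "(\<integral>\<^sup>+ x. F x \<partial>simplex_uniform n) = (\<integral>\<^sup>+ y. F (graph_point n y) \<partial>uniform_on ?L (corner n))"
    unfolding simplex_uniform_def graph_point_def[symmetric] using g F by (simp add: nn_integral_distr)
  also have "\<dots> = (\<integral>\<^sup>+ y. F (graph_point n y) * indicator (corner n) y \<partial>?L) / emeasure ?L (corner n)"
    using sets_solid_corner[of "{1..<n}"]
    by (intro nn_integral_uniform_on measurable_compose[OF measurable_graph_point[OF n] F]) (simp add: c)
  also have "emeasure ?L (corner n) = ennreal (1 / fact (n - 1))"
    using emeasure_solid_corner[of "{1..<n}"] by (simp add: c)
  finally show ?thesis
    by (simp add: divide_ennreal_def inverse_ennreal ennreal_fact)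
qed

text \<open>
  For a point \<open>z\<close> of the corner over the coordinates other than \<open>i\<close> and \<open>n\<close>, the points
  \<open>edge_point n i z u\<close> with \<open>0 \<le> u \<le> 1 - sum z\<close> run through the segment of the simplex on
  which mass is moved between the coordinates \<open>i\<close> and \<open>n\<close>.
\<close>

definition edge_point :: "nat \<Rightarrow> nat \<Rightarrow> (nat \<Rightarrow> real) \<Rightarrow> real \<Rightarrow> nat \<Rightarrow> real" where
  "edge_point n i z u = z(i := u, n := (1 - sum z ({1..<n} - {i})) - u)"

lemma edge_point_in_simplex:
  assumes "i \<in> {1..<n}" "z \<in> solid_corner ({1..<n} - {i})" "0 \<le> u" "u \<le> 1 - sum z ({1..<n} - {i})"
  shows "edge_point n i z u \<in> prob_simplex n"
proof -
  define J where "J = {1..<n} - {i}"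
  have I: "{1..n} = insert n (insert i J)" and J: "finite J" "i \<notin> J" "n \<notin> J" "i \<noteq> n"
    using assms(1) by (auto simp: J_def)
  have "sum (edge_point n i z u) J = sum z J"
    by (rule sum.cong) (auto simp: edge_point_def J_def)
  moreover have "edge_point n i z u n = 1 - sum z J - u" "edge_point n i z u i = u"
    using J by (simp_all add: edge_point_def J_def)
  ultimately have "sum (edge_point n i z u) {1..n} = 1"
    unfolding I using J by simp
  then show ?thesis
    using assms by (auto simp: prob_simplex_def edge_point_def solid_corner_def extensional_def)
qed

text \<open>
  Disintegration of the uniform distribution along the segments of direction \<open>(i, n)\<close>: on each
  of them it is a multiple of one-dimensional Lebesgue measure. Every property of the uniform
  distribution used later is read off from this formula, first for pairs that contain the
  special coordinate \<open>n\<close> and then, by a swap of coordinates, for all pairs.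
\<close>

lemma nn_integral_simplex_uniform_edges:
  assumes n: "n \<ge> 2" and i: "i \<in> {1..<n}" and F: "F \<in> borel_measurable (simplex_space n)"
  defines "J \<equiv> {1..<n} - {i}"
  shows "(\<integral>\<^sup>+ x. F x \<partial>simplex_uniform n) =
    (\<integral>\<^sup>+ z. (\<integral>\<^sup>+ u. F (edge_point n i z u) * indicator {0..1 - sum z J} u \<partial>lborel) * indicator (solid_corner J) z
       \<partial>(\<Pi>\<^sub>M k\<in>J. lborel)) * fact (n - 1)"
proof -
  interpret product_sigma_finite "\<lambda>_::nat. lborel :: real measure" ..
  let ?f = "\<lambda>y. F (graph_point n y) * indicator (corner n) y"
  have J: "insert i J = {1..<n}" "finite J" "i \<notin> J" using i by (auto simp: J_def)
  have c: "corner n = solid_corner {1..<n}" by (simp add: corner_def solid_corner_def)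
  have "corner n \<inter> space (\<Pi>\<^sub>M k\<in>{1..<n}. (lborel :: real measure)) \<in> sets (\<Pi>\<^sub>M k\<in>{1..<n}. lborel)"
    unfolding c by (intro sets.Int sets_solid_corner) auto
  moreover have "(\<lambda>y. F (graph_point n y))
      \<in> borel_measurable (restrict_space (\<Pi>\<^sub>M k\<in>{1..<n}. lborel) (corner n))"
    using n by (intro measurable_compose[OF measurable_graph_point F]) simp
  ultimately have "?f \<in> borel_measurable (\<Pi>\<^sub>M k\<in>{1..<n}. lborel)"
    by (rule iffD1[OF borel_measurable_restrict_space_iff_ennreal])
  then have "(\<integral>\<^sup>+ y. ?f y \<partial>(\<Pi>\<^sub>M k\<in>{1..<n}. lborel))
      = (\<integral>\<^sup>+ z. (\<integral>\<^sup>+ u. ?f (z(i := u)) \<partial>lborel) \<partial>(\<Pi>\<^sub>M k\<in>J. lborel))"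
    using product_nn_integral_insert[OF J(2,3), of ?f] by (simp add: J(1))
  also have "\<dots> = (\<integral>\<^sup>+ z. (\<integral>\<^sup>+ u. F (edge_point n i z u) * indicator {0..1 - sum z J} u \<partial>lborel)
      * indicator (solid_corner J) z \<partial>(\<Pi>\<^sub>M k\<in>J. lborel))"
  proof (rule nn_integral_cong)
    fix z assume "z \<in> space (\<Pi>\<^sub>M k\<in>J. (lborel :: real measure))"
    then have z: "z \<in> extensional J" by (simp add: space_PiM PiE_def)
    have s: "sum (z(i := u)) {1..<n} = u + sum z J" for u
    proof -
      have "sum (z(i := u)) J = sum z J" by (rule sum.cong) (use J in auto)
      moreover have "sum (z(i := u)) (insert i J) = (z(i := u)) i + sum (z(i := u)) J"
        by (rule sum.insert[OF J(2,3)])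
      ultimately show ?thesis unfolding J(1) by simp
    qed
    have g: "graph_point n (z(i := u)) = edge_point n i z u" for u
      unfolding graph_point_def s edge_point_def J_def[symmetric] by (simp add: algebra_simps)
    have "z(i := u) \<in> corner n \<longleftrightarrow> z \<in> solid_corner J \<and> u \<in> {0..1 - sum z J}" for u
    proof -
      have "(\<forall>k\<in>{1..<n}. 0 \<le> (z(i := u)) k) \<longleftrightarrow> 0 \<le> u \<and> (\<forall>k\<in>J. 0 \<le> z k)"
        unfolding J(1)[symmetric] using J by auto
      moreover have "z(i := u) \<in> extensional {1..<n}"
        using z J by (auto simp: extensional_def)
      ultimately show ?thesis
        using z unfolding c solid_corner_def mem_Collect_eq s by auto
    qed
    then have ind: "indicator (corner n) (z(i := u))
        = indicator {0..1 - sum z J} u * (indicator (solid_corner J) z :: ennreal)" for u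
      by (auto simp: indicator_def)
    show "(\<integral>\<^sup>+ u. ?f (z(i := u)) \<partial>lborel) =
        (\<integral>\<^sup>+ u. F (edge_point n i z u) * indicator {0..1 - sum z J} u \<partial>lborel) * indicator (solid_corner J) z"
      unfolding g ind by (cases "z \<in> solid_corner J") auto
  qed
  finally show ?thesis
    unfolding nn_integral_simplex_uniform[OF order_trans[OF one_le_numeral n] F] by simp
qed

lemma nn_integral_simplex_uniform_edges_cong:
  assumes n: "n \<ge> 2" and i: "i \<in> {1..<n}"
    and F: "F \<in> borel_measurable (simplex_space n)" and G: "G \<in> borel_measurable (simplex_space n)"
    and eq: "\<And>z. z \<in> solid_corner ({1..<n} - {i}) \<Longrightarrow>
      (\<integral>\<^sup>+ u. F (edge_point n i z u) * indicator {0..1 - sum z ({1..<n} - {i})} u \<partial>lborel)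
      = (\<integral>\<^sup>+ u. G (edge_point n i z u) * indicator {0..1 - sum z ({1..<n} - {i})} u \<partial>lborel)"
  shows "(\<integral>\<^sup>+ x. F x \<partial>simplex_uniform n) = (\<integral>\<^sup>+ x. G x \<partial>simplex_uniform n)"
  unfolding nn_integral_simplex_uniform_edges[OF n i F] nn_integral_simplex_uniform_edges[OF n i G]
proof (rule arg_cong2[where f = "(*)", OF nn_integral_cong refl], goal_cases)
  case (1 z)
  show ?case
  proof (cases "z \<in> solid_corner ({1..<n} - {i})")
    case True
    show ?thesis unfolding eq[OF True] ..
  qed simp
qed

lemma measurable_edge_point:
  fixes F :: "(nat \<Rightarrow> real) \<Rightarrow> ennreal"
  assumes i: "i \<in> {1..<n}" and z: "z \<in> solid_corner ({1..<n} - {i})"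
    and F: "F \<in> borel_measurable (simplex_space n)"
  shows "(\<lambda>u. F (edge_point n i z u) * indicator {0..1 - sum z ({1..<n} - {i})} u) \<in> borel_measurable borel"
proof -
  have "edge_point n i z \<in> restrict_space borel {0..1 - sum z ({1..<n} - {i})} \<rightarrow>\<^sub>M simplex_space n"
  proof (rule measurable_into_simplex)
    show "(\<lambda>u. edge_point n i z u k) \<in> borel_measurable (restrict_space borel {0..1 - sum z ({1..<n} - {i})})" for k
      by (cases "k = n"; cases "k = i"; rule measurable_restrict_space1) (auto simp: edge_point_def)
  qed (auto simp: space_restrict_space intro: edge_point_in_simplex[OF i z])
  note * = measurable_compose[OF this F]
  show ?thesis
    by (rule iffD1[OF borel_measurable_restrict_space_iff_ennreal, OF _ *]) simp
qed

definition swap_coords :: "nat \<Rightarrow> nat \<Rightarrow> (nat \<Rightarrow> real) \<Rightarrow> nat \<Rightarrow> real" where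
  "swap_coords i j x = x(i := x j, j := x i)"

lemma measurable_swap_coords:
  assumes ij: "i \<in> {1..n}" "j \<in> {1..n}" "i \<noteq> j"
  shows "swap_coords i j \<in> simplex_space n \<rightarrow>\<^sub>M simplex_space n"
proof (rule measurable_into_simplex)
  show "(\<lambda>x. swap_coords i j x k) \<in> borel_measurable (simplex_space n)" if "k \<in> {1..n}" for k
    using that ij by (cases "k = i"; cases "k = j") (auto simp: swap_coords_def intro: measurable_simplex_coord)
  have "sum (swap_coords i j x) {1..n} = sum x {1..n}" for x
  proof -
    have I: "{1..n} = insert i (insert j ({1..n} - {i, j}))" using ij by auto
    have "sum (swap_coords i j x) ({1..n} - {i, j}) = sum x ({1..n} - {i, j})"
      by (rule sum.cong) (auto simp: swap_coords_def)
    then show ?thesis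
      using ij by (subst (1 2) I) (simp add: swap_coords_def)
  qed
  then show "swap_coords i j \<in> space (simplex_space n) \<rightarrow> prob_simplex n"
    using ij by (auto simp: prob_simplex_def swap_coords_def extensional_def)
qed

text \<open>
  The swap acts on each segment as the reflection \<open>u \<mapsto> r - u\<close>.
\<close>

lemma nn_integral_simplex_uniform_swap_last:
  assumes n: "n \<ge> 2" and i: "i \<in> {1..<n}" and F: "F \<in> borel_measurable (simplex_space n)"
  shows "(\<integral>\<^sup>+ x. F (swap_coords i n x) \<partial>simplex_uniform n) = (\<integral>\<^sup>+ x. F x \<partial>simplex_uniform n)"
proof -
  let ?J = "{1..<n} - {i}"
  have m: "(\<lambda>x. F (swap_coords i n x)) \<in> borel_measurable (simplex_space n)"
    using i by (intro measurable_compose[OF measurable_swap_coords F]) auto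
  have "(\<integral>\<^sup>+ u. F (swap_coords i n (edge_point n i z u)) * indicator {0..1 - sum z ?J} u \<partial>lborel)
      = (\<integral>\<^sup>+ u. F (edge_point n i z u) * indicator {0..1 - sum z ?J} u \<partial>lborel)"
    if z: "z \<in> solid_corner ?J" for z
  proof -
    define r where "r = 1 - sum z ?J"
    have "swap_coords i n (edge_point n i z u) = edge_point n i z (r - u)" for u
      using i by (auto simp: swap_coords_def edge_point_def r_def)
    moreover have "indicator {0..r} u = (indicator {0..r} (r - u) :: ennreal)" for u
      by (auto simp: indicator_def)
    moreover note nn_integral_real_affine[OF measurable_edge_point[OF i z F, folded r_def], of "-1" r]
    ultimately show ?thesis unfolding r_def[symmetric] by simp
  qed
  then show ?thesis by (rule nn_integral_simplex_uniform_edges_cong[OF n i m F])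
qed

text \<open>
  Resampling the pair \<open>(i, n)\<close> replaces a function on each segment by its mean over that
  segment.
\<close>

lemma nn_integral_simplex_uniform_resample_last:
  assumes n: "n \<ge> 2" and i: "i \<in> {1..<n}" and F: "F \<in> borel_measurable (simplex_space n)"
  shows "(\<integral>\<^sup>+ x. resample (i, n) F x \<partial>simplex_uniform n) = (\<integral>\<^sup>+ x. F x \<partial>simplex_uniform n)"
proof -
  let ?J = "{1..<n} - {i}"
  have p: "(i, n) \<in> index_pairs n" using i by (auto simp: index_pairs_def)
  have m: "resample (i, n) F \<in> borel_measurable (simplex_space n)"
    by (rule measurable_resample[OF F p])
  have "(\<integral>\<^sup>+ u. resample (i, n) F (edge_point n i z u) * indicator {0..1 - sum z ?J} u \<partial>lborel)
      = (\<integral>\<^sup>+ u. F (edge_point n i z u) * indicator {0..1 - sum z ?J} u \<partial>lborel)"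
    if z: "z \<in> solid_corner ?J" for z
  proof -
    define r where "r = 1 - sum z ?J"
    have r: "0 \<le> r" using z by (simp add: r_def solid_corner_def)
    have e: "edge_point n i z u \<in> prob_simplex n" if "u \<in> {0..r}" for u
      using edge_point_in_simplex[OF i z] that by (auto simp: r_def)
    have upd: "gibbs_update i n l (edge_point n i z u) = edge_point n i z (0 + r * l)" for l u
      using i by (auto simp: gibbs_update_def edge_point_def r_def algebra_simps)
    have const: "resample (i, n) F (edge_point n i z u)
        = (\<integral>\<^sup>+ l. F (edge_point n i z (0 + r * l)) * indicator {0..1} l \<partial>lborel)" (is "_ = ?K")
      if "u \<in> {0..r}" for u
      using nn_integral_unit_law[OF measurable_comp_upd[OF F p e[OF that]]]
      by (simp add: resample_def upd)
    have "(\<integral>\<^sup>+ u. resample (i, n) F (edge_point n i z u) * indicator {0..r} u \<partial>lborel)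
        = (\<integral>\<^sup>+ u. ?K * indicator {0..r} u \<partial>lborel)"
      using const by (intro nn_integral_cong) (auto simp: indicator_def)
    also have "\<dots> = ?K * ennreal r"
      using r by (simp add: nn_integral_cmult_indicator)
    also have "\<dots> = (\<integral>\<^sup>+ u. F (edge_point n i z u) * indicator {0..r} u \<partial>lborel)"
    proof (cases "r = 0")
      case True
      have "(\<integral>\<^sup>+ u. F (edge_point n i z u) * indicator {0::real} u \<partial>lborel) = 0"
        by (rule nn_integral_0_iff_AE[THEN iffD2]) 
           (use True AE_lborel_singleton[of 0] measurable_edge_point[OF i z F] in \<open>auto simp: r_def\<close>)
      then show ?thesis using True by simp
    next
      case False
      have "indicator {0..r} (0 + r * l) = (indicator {0..1} l :: ennreal)" for l
        using False r by (auto simp: indicator_def zero_le_mult_iff mult_le_cancel_left1)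
      moreover note nn_integral_real_affine[OF measurable_edge_point[OF i z F, folded r_def], of r 0]
      ultimately show ?thesis using False r by (simp add: mult.commute)
    qed
    finally show ?thesis by (simp add: r_def)
  qed
  then show ?thesis by (rule nn_integral_simplex_uniform_edges_cong[OF n i m F])
qed

lemma sets_simplex_uniform [simp]: "sets (simplex_uniform n) = sets (simplex_space n)"
  by (simp add: simplex_uniform_def)

lemma space_simplex_uniform [simp]: "space (simplex_uniform n) = prob_simplex n"
  by (simp add: simplex_uniform_def)

lemma resample_swap:
  assumes "i < j" "j < n"
  shows "resample (i, j) F (swap_coords j n x) = resample (i, n) (\<lambda>z. F (swap_coords j n z)) x"
proof -
  have "gibbs_update i j l (swap_coords j n x) = swap_coords j n (gibbs_update i n l x)" for l
    using assms by (auto simp: gibbs_update_def swap_coords_def)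
  then show ?thesis by (simp add: resample_def)
qed

text \<open>
  A pair \<open>(i, j)\<close> with \<open>j < n\<close> is conjugate to \<open>(i, n)\<close> under the swap of \<open>j\<close> and \<open>n\<close>, which
  preserves the uniform distribution.
\<close>

lemma nn_integral_simplex_uniform_resample:
  assumes n: "n \<ge> 2" and p: "p \<in> index_pairs n" and F: "F \<in> borel_measurable (simplex_space n)"
  shows "(\<integral>\<^sup>+ x. resample p F x \<partial>simplex_uniform n) = (\<integral>\<^sup>+ x. F x \<partial>simplex_uniform n)"
proof -
  obtain i j where ij: "p = (i, j)" "1 \<le> i" "i < j" "j \<le> n"
    using p by (auto simp: index_pairs_def)
  show ?thesis
  proof (cases "j = n")
    case True
    then show ?thesis using nn_integral_simplex_uniform_resample_last[OF n _ F, of i] ij by simp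
  next
    case False
    then have j: "j \<in> {1..<n}" and i: "i \<in> {1..<n}" using ij by auto
    have Fs: "(\<lambda>x. F (swap_coords j n x)) \<in> borel_measurable (simplex_space n)"
      using j by (intro measurable_compose[OF measurable_swap_coords F]) auto
    have "(\<integral>\<^sup>+ x. resample p F x \<partial>simplex_uniform n)
        = (\<integral>\<^sup>+ x. resample (i, j) F (swap_coords j n x) \<partial>simplex_uniform n)"
      using nn_integral_simplex_uniform_swap_last[OF n j measurable_resample[OF F p]] by (simp add: ij)
    also have "\<dots> = (\<integral>\<^sup>+ x. resample (i, n) (\<lambda>z. F (swap_coords j n z)) x \<partial>simplex_uniform n)"
      using resample_swap[of i j n F] ij j by simp
    also have "\<dots> = (\<integral>\<^sup>+ x. F (swap_coords j n x) \<partial>simplex_uniform n)"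
      by (rule nn_integral_simplex_uniform_resample_last[OF n i Fs])
    also have "\<dots> = (\<integral>\<^sup>+ x. F x \<partial>simplex_uniform n)"
      by (rule nn_integral_simplex_uniform_swap_last[OF n j F])
    finally show ?thesis .
  qed
qed

lemma nn_integral_simplex_uniform_gibbs_op:
  assumes n: "n \<ge> 2" and F: "F \<in> borel_measurable (simplex_space n)"
  shows "(\<integral>\<^sup>+ x. gibbs_op n F x \<partial>simplex_uniform n) = (\<integral>\<^sup>+ x. F x \<partial>simplex_uniform n)"
proof -
  have "(\<integral>\<^sup>+ x. gibbs_op n F x \<partial>simplex_uniform n)
      = (\<Sum>p\<in>index_pairs n. (\<integral>\<^sup>+ x. resample p F x \<partial>simplex_uniform n) * ennreal (1 / card (index_pairs n)))"
    unfolding gibbs_op_def nn_integral_pair_law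
    using measurable_resample[OF F]
    by (subst nn_integral_sum)
       (auto simp: nn_integral_multc measurable_cong_sets[OF sets_simplex_uniform refl]
         intro!: borel_measurable_times_ennreal)
  also have "\<dots> = (\<integral>\<^sup>+ p. (\<integral>\<^sup>+ x. F x \<partial>simplex_uniform n) \<partial>pair_law n)"
    unfolding nn_integral_pair_law using nn_integral_simplex_uniform_resample[OF n _ F] by simp
  finally show ?thesis unfolding nn_integral_pair_law_const[OF n] .
qed

lemma nn_integral_simplex_uniform_gibbs_op_pow:
  assumes n: "n \<ge> 2" and F: "F \<in> borel_measurable (simplex_space n)"
  shows "(\<integral>\<^sup>+ x. (gibbs_op n ^^ t) F x \<partial>simplex_uniform n) = (\<integral>\<^sup>+ x. F x \<partial>simplex_uniform n)"
  by (induction t) (simp_all add: nn_integral_simplex_uniform_gibbs_op[OF n measurable_gibbs_op_pow[OF F]])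

text \<open>
  On a segment of direction \<open>(i, n)\<close> the sum \<open>x i + x n\<close> is the length \<open>r\<close> of the segment, so
  its inverse integrates to 1 there; what remains is the ratio of the volumes of the solid
  corners of dimensions \<open>n - 2\<close> and \<open>n - 1\<close>, which is \<open>n - 1\<close>. This controls how often the
  second phase of the coupling fails.
\<close>

lemma nn_integral_inverse_pair_sum:
  assumes n: "n \<ge> 2" and p: "p \<in> index_pairs n"
  shows "(\<integral>\<^sup>+ x. 1 / ennreal (x (fst p) + x (snd p)) \<partial>simplex_uniform n) \<le> ennreal (real n - 1)"
proof -
  obtain i j where ij: "p = (i, j)" "1 \<le> i" "i < j" "j \<le> n"
    using p by (auto simp: index_pairs_def)
  have i: "i \<in> {1..<n}" using ij by auto
  let ?F = "\<lambda>x. 1 / ennreal (x i + x n)"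
  let ?J = "{1..<n} - {i}"
  have F: "?F \<in> borel_measurable (simplex_space n)"
    using i by (intro borel_measurable_divide_ennreal measurable_compose[OF _ measurable_ennreal]
        borel_measurable_add measurable_simplex_coord) auto
  have inner: "(\<integral>\<^sup>+ u. ?F (edge_point n i z u) * indicator {0..1 - sum z ?J} u \<partial>lborel) \<le> 1"
    if z: "z \<in> solid_corner ?J" for z
  proof -
    define r where "r = 1 - sum z ?J"
    have r: "0 \<le> r" using z by (simp add: r_def solid_corner_def)
    have "?F (edge_point n i z u) = 1 / ennreal r" for u
      using i by (simp add: edge_point_def r_def)
    then have "(\<integral>\<^sup>+ u. ?F (edge_point n i z u) * indicator {0..r} u \<partial>lborel) = 1 / ennreal r * ennreal r"
      using r by (simp add: nn_integral_cmult_indicator)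
    also have "\<dots> \<le> 1"
      using r by (cases "r = 0") (auto simp: divide_ennreal_def ennreal_inverse_mult inverse_ennreal
          simp flip: ennreal_mult)
    finally show ?thesis by (simp add: r_def)
  qed
  have "(\<integral>\<^sup>+ x. ?F x \<partial>simplex_uniform n)
      \<le> (\<integral>\<^sup>+ z. indicator (solid_corner ?J) z \<partial>(\<Pi>\<^sub>M k\<in>?J. lborel)) * fact (n - 1)"
    unfolding nn_integral_simplex_uniform_edges[OF n i F]
    by (intro mult_right_mono nn_integral_mono) (use inner in \<open>auto simp: indicator_def\<close>)
  also have "\<dots> = ennreal (1 / fact (n - 2)) * fact (n - 1)"
  proof -
    have "card ?J = n - 2" using i by (simp add: card_Diff_singleton)
    then show ?thesis using emeasure_solid_corner[of ?J] sets_solid_corner[of ?J] by simp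
  qed
  also have "\<dots> = ennreal (real n - 1)"
  proof -
    have "n - 1 = Suc (n - 2)" using n by simp
    then have "fact (n - 1) = (real n - 1) * fact (n - 2)" using n by (simp add: of_nat_diff)
    then have "1 / fact (n - 2) * fact (n - 1) = real n - 1" by simp
    then show ?thesis
      unfolding ennreal_fact[symmetric] by (subst ennreal_mult[symmetric]) simp_all
  qed
  finally have main: "(\<integral>\<^sup>+ x. ?F x \<partial>simplex_uniform n) \<le> ennreal (real n - 1)" .
  show ?thesis
  proof (cases "j = n")
    case False
    then have j: "j \<in> {1..<n}" using ij by auto
    have "?F (swap_coords j n x) = 1 / ennreal (x i + x j)" for x
      using ij False by (simp add: swap_coords_def)
    with main nn_integral_simplex_uniform_swap_last[OF n j F] show ?thesis by (simp add: ij)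
  qed (use main ij in simp)
qed

text \<open>
  A segment of direction \<open>(i, n)\<close> meets the two hyperplanes \<open>x i = 0\<close> and \<open>x n = 0\<close> only in
  its end points.
\<close>

lemma simplex_uniform_coord_eq_0:
  assumes n: "n \<ge> 2" and k: "k \<in> {1..n}"
  shows "emeasure (simplex_uniform n) {x \<in> prob_simplex n. x k = 0} = 0"
proof -
  define i where "i = (if k = n then 1 else k)"
  have i: "i \<in> {1..<n}" using n k by (auto simp: i_def)
  let ?A = "{x \<in> prob_simplex n. x k = 0}" and ?J = "{1..<n} - {i}"
  have "?A = (\<lambda>x. x k) -` {0} \<inter> space (simplex_space n)" by auto
  also have "\<dots> \<in> sets (simplex_space n)"
    by (rule measurable_sets[OF measurable_simplex_coord[OF k]]) simp
  finally have A: "?A \<in> sets (simplex_space n)" .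
  have null: "(\<integral>\<^sup>+ u. indicator ?A (edge_point n i z u) * indicator {0..1 - sum z ?J} u \<partial>lborel) = 0" for z
  proof -
    define r where "r = 1 - sum z ?J"
    have u: "u \<in> {0, r}" if "edge_point n i z u k = 0" for u
      using that i by (cases "k = n") (auto simp: edge_point_def r_def i_def)
    have "indicator ?A (edge_point n i z u) * indicator {0..r} u \<le> (indicator {0, r} u :: ennreal)" for u
      using u[of u] by (cases "edge_point n i z u k = 0") (simp_all split: split_indicator)
    then have "(\<integral>\<^sup>+ u. indicator ?A (edge_point n i z u) * indicator {0..r} u \<partial>lborel)
        \<le> (\<integral>\<^sup>+ u. indicator {0, r} u \<partial>lborel)"
      by (rule nn_integral_mono)
    also have "\<dots> = emeasure lborel {0, r}"
      by (rule nn_integral_indicator) simp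
    also have "\<dots> = 0" by (rule emeasure_lborel_countable) simp
    finally show ?thesis unfolding r_def by simp
  qed
  have "emeasure (simplex_uniform n) ?A = (\<integral>\<^sup>+ x. indicator ?A x \<partial>simplex_uniform n)"
    using A by (intro nn_integral_indicator[symmetric]) (simp only: sets_simplex_uniform)
  also have "\<dots> = 0"
    unfolding nn_integral_simplex_uniform_edges[OF n i borel_measurable_indicator[OF A]] null by simp
  finally show ?thesis .
qed

section \<open>Coupling along a fixed sequence of pairs\<close>

text \<open>
  The one-dimensional coupling. If \<open>l\<close> is uniform on the unit interval, \<open>m\<close> is chosen such
  that \<open>m * sx = l * sy + d\<close>; then \<open>m\<close> is uniform as well, except for the part of the mass
  where the intervals of length \<open>sx\<close> and \<open>sy\<close>, shifted against each other by \<open>d\<close>, do not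
  overlap. The integration variable of \<open>b\<close> and \<open>v\<close> is \<open>l\<close> throughout, so that the cost \<open>v\<close>
  enters with its exact mean and only \<open>a\<close> pays for the change of variables.
\<close>

lemma shifted_uniform_comparison:
  fixes a b v :: "real \<Rightarrow> ennreal" and sx sy d :: real
  assumes a: "a \<in> borel_measurable unit_law" and b: "b \<in> borel_measurable unit_law"
    and v: "v \<in> borel_measurable unit_law"
    and a1: "\<And>l. l \<in> {0..1} \<Longrightarrow> a l \<le> 1" and b1: "\<And>l. l \<in> {0..1} \<Longrightarrow> b l \<le> 1"
    and sx: "0 < sx" and sy: "0 < sy"
    and le: "\<And>l m. l \<in> {0..1} \<Longrightarrow> m \<in> {0..1} \<Longrightarrow> m * sx = l * sy + d \<Longrightarrow> b l \<le> a m + v l"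
  shows "(\<integral>\<^sup>+ l. b l \<partial>unit_law) \<le> (\<integral>\<^sup>+ l. a l \<partial>unit_law) + (\<integral>\<^sup>+ l. v l \<partial>unit_law)
    + ennreal ((max 0 (- d) + max 0 (sy + d - sx) + max 0 (sx - sy)) / sy)"
proof -
  let ?I = "{0..1::real}"
  \<comment> \<open>\<open>\<phi> l\<close> is the partner \<open>m\<close> of \<open>l\<close>; \<open>q1\<close>, \<open>q2\<close> bound the lengths of the parts of the unit interval where it is below 0 or above 1, and \<open>q3\<close> pays for a Jacobian larger than 1.\<close>
  define A where "A m = a m * indicator ?I m" for m
  define V where "V l = v l * indicator ?I l" for l
  define \<phi> where "\<phi> l = d / sx + sy / sx * l" for l
  define q1 where "q1 = max 0 (- d) / sy"
  define q2 where "q2 = max 0 (sy + d - sx) / sy"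
  define q3 where "q3 = max 0 (sx - sy) / sy"
  have q: "0 \<le> q1" "0 \<le> q2" "0 \<le> q3" using sy by (simp_all add: q1_def q2_def q3_def)
  have restr: "(\<lambda>l. f l * indicator ?I l) \<in> borel_measurable borel"
    if "f \<in> borel_measurable unit_law" for f :: "real \<Rightarrow> ennreal"
  proof -
    have "f \<in> borel_measurable (restrict_space lborel ?I)"
      using that unfolding measurable_unit_law_iff .
    then have "(\<lambda>l. f l * indicator ?I l) \<in> borel_measurable lborel"
      by (rule iffD1[OF borel_measurable_restrict_space_iff_ennreal, rotated]) simp
    then show ?thesis by simp
  qed
  have Am: "A \<in> borel_measurable borel" using restr[OF a] by (simp add: A_def[abs_def])
  have Vm: "V \<in> borel_measurable borel" using restr[OF v] by (simp add: V_def[abs_def])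
  have A\<phi>m: "(\<lambda>l. A (\<phi> l)) \<in> borel_measurable borel"
    unfolding \<phi>_def by (rule measurable_compose[OF _ Am]) simp
  have pointwise: "b l * indicator ?I l \<le> A (\<phi> l) + V l + indicator {0..q1} l + indicator {1 - q2..1} l" for l
  proof (cases "l \<in> ?I")
    case l: True
    have \<phi>: "\<phi> l * sx = l * sy + d" using sx by (simp add: \<phi>_def field_simps)
    consider "\<phi> l \<in> ?I" | "\<phi> l < 0" | "1 < \<phi> l" by fastforce
    then show ?thesis
    proof cases
      case 1
      then have "b l \<le> A (\<phi> l) + V l" using le[OF l 1 \<phi>] l by (simp add: A_def V_def)
      also have "A (\<phi> l) + V l \<le> A (\<phi> l) + V l + indicator {0..q1} l + indicator {1 - q2..1} l"
        by (intro add_increasing2 order_refl) simp_all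
      finally show ?thesis using l by simp
    next
      case 2
      then have "l * sy + d < 0" using \<phi> sx by (metis mult_less_0_iff)
      then have "l \<le> q1" using sy by (simp add: q1_def pos_le_divide_eq)
      then show ?thesis using l b1[OF l] by (simp add: add_increasing2 add_increasing)
    next
      case 3
      then have "sx < \<phi> l * sx" using sx by simp
      then have "sx < l * sy + d" using \<phi> by simp
      then have "(1 - l) * sy \<le> sy + d - sx" by (simp add: algebra_simps)
      then have "1 - l \<le> q2" using sy by (simp add: q2_def pos_le_divide_eq)
      then show ?thesis using l b1[OF l] by (simp add: add_increasing2 add_increasing)
    qed
  qed simp
  have "(\<integral>\<^sup>+ l. b l \<partial>unit_law) = (\<integral>\<^sup>+ l. b l * indicator ?I l \<partial>lborel)"
    by (rule nn_integral_unit_law[OF b])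
  also have "\<dots> \<le> (\<integral>\<^sup>+ l. A (\<phi> l) + V l + indicator {0..q1} l + indicator {1 - q2..1} l \<partial>lborel)"
    by (rule nn_integral_mono[OF pointwise])
  also have "\<dots> = (\<integral>\<^sup>+ l. A (\<phi> l) \<partial>lborel) + (\<integral>\<^sup>+ l. V l \<partial>lborel) + ennreal q1 + ennreal q2"
    using Vm A\<phi>m q by (simp add: nn_integral_add)
  also have "(\<integral>\<^sup>+ l. A (\<phi> l) \<partial>lborel) \<le> (\<integral>\<^sup>+ l. A l \<partial>lborel) + ennreal q3"
  proof -
    let ?S = "\<integral>\<^sup>+ l. A l \<partial>lborel"
    have "?S = ennreal (sy / sx) * (\<integral>\<^sup>+ l. A (\<phi> l) \<partial>lborel)"
      using nn_integral_real_affine[OF Am, of "sy / sx" "d / sx"] sx sy by (simp add: \<phi>_def)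
    then have "ennreal (sx / sy) * ?S = (ennreal (sx / sy) * ennreal (sy / sx)) * (\<integral>\<^sup>+ l. A (\<phi> l) \<partial>lborel)"
      by (simp add: mult.assoc)
    also have "ennreal (sx / sy) * ennreal (sy / sx) = 1"
      using sx sy by (simp flip: ennreal_mult)
    finally have eq: "(\<integral>\<^sup>+ l. A (\<phi> l) \<partial>lborel) = ennreal (sx / sy) * ?S" by simp
    have "?S \<le> (\<integral>\<^sup>+ l. indicator ?I l \<partial>lborel)"
      using a1 by (intro nn_integral_mono) (auto simp: A_def indicator_def)
    then have S1: "?S \<le> 1" by simp
    have "sx / sy \<le> 1 + q3" using sy by (simp add: q3_def divide_simps)
    then have "ennreal (sx / sy) * ?S \<le> (1 + ennreal q3) * ?S"
      using q by (intro mult_right_mono) (simp_all flip: ennreal_1 ennreal_plus add: ennreal_leI)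
    also have "\<dots> \<le> ?S + ennreal q3"
      using mult_left_mono[OF S1, of "ennreal q3"] by (simp add: distrib_right)
    finally show ?thesis unfolding eq .
  qed
  finally have "(\<integral>\<^sup>+ l. b l \<partial>unit_law)
      \<le> (\<integral>\<^sup>+ l. A l \<partial>lborel) + ennreal q3 + (\<integral>\<^sup>+ l. V l \<partial>lborel) + ennreal q1 + ennreal q2"
    by (simp add: add_right_mono)
  also have "\<dots> = (\<integral>\<^sup>+ l. A l \<partial>lborel) + (\<integral>\<^sup>+ l. V l \<partial>lborel) + ennreal (q1 + q2 + q3)"
    using q by (simp add: ennreal_plus ac_simps)
  also have "q1 + q2 + q3 = (max 0 (- d) + max 0 (sy + d - sx) + max 0 (sx - sy)) / sy"
    by (simp add: q1_def q2_def q3_def add_divide_distrib)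
  finally show ?thesis
    unfolding A_def V_def nn_integral_unit_law[OF a] nn_integral_unit_law[OF v] .
qed

definition fibre :: "nat \<Rightarrow> (nat \<Rightarrow> nat) \<Rightarrow> nat \<Rightarrow> nat set" where
  "fibre n L c = {k \<in> {1..n}. L k = c}"

text \<open>
  The labelling \<open>L\<close> stands for the partition of the coordinates into its fibres. On each class
  the two points have the same total mass and \<open>L1\<close>-distance at most \<open>e\<close>. Bounding the distance
  class by class, instead of on the whole simplex, is what makes the bound stable under
  splitting.
\<close>

definition aligned :: "nat \<Rightarrow> (nat \<Rightarrow> nat) \<Rightarrow> real \<Rightarrow> (nat \<Rightarrow> real) \<Rightarrow> (nat \<Rightarrow> real) \<Rightarrow> bool" where
  "aligned n L e x y \<longleftrightarrow>
    (\<forall>c. (\<Sum>k\<in>fibre n L c. x k - y k) = 0 \<and> (\<Sum>k\<in>fibre n L c. \<bar>x k - y k\<bar>) \<le> e)"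

definition merge_classes :: "(nat \<Rightarrow> nat) \<Rightarrow> nat \<Rightarrow> nat \<Rightarrow> nat \<Rightarrow> nat" where
  "merge_classes L i j k = (if L k = L i then L j else L k)"

lemma finite_fibre [simp]: "finite (fibre n L c)"
  by (simp add: fibre_def)

text \<open>
  Two coordinates of one class, resampled with the same \<open>l\<close>: their differences become \<open>l\<close> and
  \<open>1 - l\<close> times the sum of the old ones.
\<close>

lemma aligned_update_same:
  assumes i: "i \<in> {1..n}" and j: "j \<in> {1..n}" and ij: "i \<noteq> j" and L: "L i = L j"
    and al: "aligned n L e x y" and l: "l \<in> {0..1}"
  shows "aligned n L e (gibbs_update i j l x) (gibbs_update i j l y)"
  unfolding aligned_def
proof
  fix c
  let ?S = "fibre n L c"
  define D where "D k = x k - y k" for k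
  define D' where "D' k = gibbs_update i j l x k - gibbs_update i j l y k" for k
  have h: "sum D ?S = 0" "(\<Sum>k\<in>?S. \<bar>D k\<bar>) \<le> e"
    using al by (auto simp: aligned_def D_def)
  have other: "D' k = D k" if "k \<noteq> i" "k \<noteq> j" for k
    using that by (simp add: D_def D'_def gibbs_update_def)
  have Di: "D' i = l * (D i + D j)" and Dj: "D' j = (1 - l) * (D i + D j)"
    using ij by (simp_all add: D_def D'_def gibbs_update_def algebra_simps)
  have "sum D' ?S = 0 \<and> (\<Sum>k\<in>?S. \<bar>D' k\<bar>) \<le> e"
  proof (cases "c = L i")
    case True
    define R where "R = ?S - {i, j}"
    have S: "?S = insert i (insert j R)" and R: "finite R" "i \<notin> R" "j \<notin> R"
      using i j L True by (auto simp: R_def fibre_def)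
    have split: "sum g ?S = g i + g j + sum g R" for g :: "nat \<Rightarrow> real"
      unfolding S using R ij by simp
    have R1: "sum D' R = sum D R" "(\<Sum>k\<in>R. \<bar>D' k\<bar>) = (\<Sum>k\<in>R. \<bar>D k\<bar>)"
      using R by (auto intro!: sum.cong arg_cong[where f = abs] other)
    have "\<bar>D' i\<bar> + \<bar>D' j\<bar> = \<bar>D i + D j\<bar>"
      using l unfolding Di Dj abs_mult by (simp add: algebra_simps)
    moreover have "D' i + D' j = D i + D j" unfolding Di Dj by (simp add: algebra_simps)
    ultimately show ?thesis using h unfolding split R1 by linarith
  next
    case False
    then have "sum D' ?S = sum D ?S" "(\<Sum>k\<in>?S. \<bar>D' k\<bar>) = (\<Sum>k\<in>?S. \<bar>D k\<bar>)"
      using L by (auto intro!: sum.cong arg_cong[where f = abs] other simp: fibre_def)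
    then show ?thesis using h by simp
  qed
  then show "(\<Sum>k\<in>?S. gibbs_update i j l x k - gibbs_update i j l y k) = 0
      \<and> (\<Sum>k\<in>?S. \<bar>gibbs_update i j l x k - gibbs_update i j l y k\<bar>) \<le> e"
    by (simp add: D'_def)
qed

lemma aligned_mergeD:
  assumes i: "i \<in> {1..n}" and j: "j \<in> {1..n}" and L: "L i \<noteq> L j"
    and al: "aligned n (merge_classes L i j) e x y"
  defines "D \<equiv> \<lambda>k. x k - y k"
  defines "A \<equiv> fibre n L (L i) - {i}" and "B \<equiv> fibre n L (L j) - {j}"
  shows "D i + D j + sum D A + sum D B = 0"
    and "\<bar>D i\<bar> + \<bar>D j\<bar> + (\<Sum>k\<in>A. \<bar>D k\<bar>) + (\<Sum>k\<in>B. \<bar>D k\<bar>) \<le> e"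
proof -
  have S: "fibre n (merge_classes L i j) (L j) = insert i (insert j (A \<union> B))"
    using i j L by (auto simp: fibre_def merge_classes_def A_def B_def)
  have "finite A" "finite B" "A \<inter> B = {}" "i \<notin> A \<union> B" "j \<notin> A \<union> B" "i \<noteq> j"
    using L by (auto simp: A_def B_def fibre_def)
  then have split: "sum g (insert i (insert j (A \<union> B))) = g i + g j + sum g A + sum g B" for g :: "nat \<Rightarrow> real"
    by (simp add: sum.union_disjoint)
  have "sum D (insert i (insert j (A \<union> B))) = 0 \<and> (\<Sum>k\<in>insert i (insert j (A \<union> B)). \<bar>D k\<bar>) \<le> e"
    using al unfolding aligned_def D_def S[symmetric] by blast
  then show "D i + D j + sum D A + sum D B = 0"
    and "\<bar>D i\<bar> + \<bar>D j\<bar> + (\<Sum>k\<in>A. \<bar>D k\<bar>) + (\<Sum>k\<in>B. \<bar>D k\<bar>) \<le> e"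
    unfolding split by auto
qed

text \<open>
  The choice of \<open>m\<close> gives the class of \<open>i\<close> equal mass in both copies, hence also the class of
  \<open>j\<close>. The new difference at \<open>i\<close> is minus the sum of the differences on the rest of its class;
  as the differences on the merged class sum to zero, its modulus is at most the sum of the
  moduli at \<open>i\<close>, at \<open>j\<close> and on the rest of the class of \<open>j\<close>. So neither part exceeds the old
  \<open>L1\<close>-distance, and the distance bound \<open>e\<close> is inherited by every class through all splits.
\<close>

lemma aligned_update_split:
  assumes i: "i \<in> {1..n}" and j: "j \<in> {1..n}" and L: "L i \<noteq> L j"
    and al: "aligned n (merge_classes L i j) e x y"
    and m: "m * (x i + x j) = l * (y i + y j) - (\<Sum>k\<in>fibre n L (L i) - {i}. x k - y k)"
  shows "aligned n L e (gibbs_update i j m x) (gibbs_update i j l y)"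
  unfolding aligned_def
proof
  fix c
  define D where "D k = x k - y k" for k
  define D' where "D' k = gibbs_update i j m x k - gibbs_update i j l y k" for k
  define A where "A = fibre n L (L i) - {i}"
  define B where "B = fibre n L (L j) - {j}"
  note h = aligned_mergeD[OF i j L al, folded D_def A_def B_def]
  have ij: "i \<noteq> j" using L by auto
  have A: "fibre n L (L i) = insert i A" "i \<notin> A" "j \<notin> A" "finite A"
    using i L by (auto simp: A_def fibre_def)
  have B: "fibre n L (L j) = insert j B" "i \<notin> B" "j \<notin> B" "finite B"
    using j L by (auto simp: B_def fibre_def)
  have other: "D' k = D k" if "k \<noteq> i" "k \<noteq> j" for k
    using that by (simp add: D_def D'_def gibbs_update_def)
  have cong: "sum D' S = sum D S" "(\<Sum>k\<in>S. \<bar>D' k\<bar>) = (\<Sum>k\<in>S. \<bar>D k\<bar>)" if "i \<notin> S" "j \<notin> S" for S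
    using that by (auto intro!: sum.cong arg_cong[where f = abs] other)
  have Di: "D' i = - sum D A"
    using ij m by (simp add: D'_def D_def gibbs_update_def A_def)
  have "D' j = D i + D j - D' i"
    using ij by (simp add: D'_def D_def gibbs_update_def algebra_simps)
  then have Dj: "D' j = - sum D B" using Di h(1) by simp
  have absA: "\<bar>sum D A\<bar> \<le> (\<Sum>k\<in>A. \<bar>D k\<bar>)" and absB: "\<bar>sum D B\<bar> \<le> (\<Sum>k\<in>B. \<bar>D k\<bar>)"
    by (rule sum_abs)+
  consider "c = L i" | "c = L j" | "c \<noteq> L i" "c \<noteq> L j" by blast
  then have "sum D' (fibre n L c) = 0 \<and> (\<Sum>k\<in>fibre n L c. \<bar>D' k\<bar>) \<le> e"
  proof cases
    case 1
    have "\<bar>D' i\<bar> + (\<Sum>k\<in>A. \<bar>D k\<bar>) \<le> e" using h absB Di by linarith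
    then show ?thesis using A cong[OF A(2,3)] Di unfolding 1 A(1) by simp
  next
    case 2
    have "\<bar>D' j\<bar> + (\<Sum>k\<in>B. \<bar>D k\<bar>) \<le> e" using h absA Dj by linarith
    then show ?thesis using B cong[OF B(2,3)] Dj unfolding 2 B(1) by simp
  next
    case 3
    have "fibre n L c = fibre n (merge_classes L i j) c"
      using 3 by (auto simp: fibre_def merge_classes_def)
    moreover have "i \<notin> fibre n L c" "j \<notin> fibre n L c" using 3 by (auto simp: fibre_def)
    ultimately show ?thesis using al cong[of "fibre n L c"] by (simp add: aligned_def D_def)
  qed
  then show "(\<Sum>k\<in>fibre n L c. gibbs_update i j m x k - gibbs_update i j l y k) = 0
      \<and> (\<Sum>k\<in>fibre n L c. \<bar>gibbs_update i j m x k - gibbs_update i j l y k\<bar>) \<le> e"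
    by (simp add: D'_def)
qed

primrec seq_op :: "(nat \<times> nat) list \<Rightarrow> ((nat \<Rightarrow> real) \<Rightarrow> ennreal) \<Rightarrow> (nat \<Rightarrow> real) \<Rightarrow> ennreal" where
  "seq_op [] f = f"
| "seq_op (p # ps) f = resample p (seq_op ps f)"

text \<open>
  Two coordinates carry the same label if and only if the pairs of the list, read as edges,
  connect them. The list is consumed from the front by the chain, so classes split as time
  advances.
\<close>

primrec merge_label :: "(nat \<times> nat) list \<Rightarrow> nat \<Rightarrow> nat" where
  "merge_label [] = id"
| "merge_label (p # ps) = merge_classes (merge_label ps) (fst p) (snd p)"

text \<open>
  An upper bound for the probability that the coupling fails, as a function of the second copy
  only. Charging \<open>e / (y i + y j)\<close> at every step, even where no class splits, costs a factor
  that the final estimate absorbs. At \<open>y i + y j = 0\<close> the charge is infinite.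
\<close>

primrec split_cost :: "real \<Rightarrow> (nat \<times> nat) list \<Rightarrow> (nat \<Rightarrow> real) \<Rightarrow> ennreal" where
  "split_cost e [] = (\<lambda>_. 0)"
| "split_cost e (p # ps) = (\<lambda>y. resample p (split_cost e ps) y + ennreal e / ennreal (y (fst p) + y (snd p)))"

lemma measurable_seq_op:
  "f \<in> borel_measurable (simplex_space n) \<Longrightarrow> set ps \<subseteq> index_pairs n
    \<Longrightarrow> seq_op ps f \<in> borel_measurable (simplex_space n)"
  by (induction ps) (auto intro: measurable_resample)

lemma measurable_inverse_pair_sum:
  assumes "p \<in> index_pairs n"
  shows "(\<lambda>y. c / ennreal (y (fst p) + y (snd p))) \<in> borel_measurable (simplex_space n)"
  using assms
  by (intro borel_measurable_divide_ennreal measurable_compose[OF _ measurable_ennreal]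
      borel_measurable_add measurable_simplex_coord) (auto simp: index_pairs_def)

lemma measurable_split_cost:
  "set ps \<subseteq> index_pairs n \<Longrightarrow> split_cost e ps \<in> borel_measurable (simplex_space n)"
  by (induction ps) (auto intro!: measurable_resample measurable_inverse_pair_sum borel_measurable_add)

lemma resample_le_1:
  assumes "\<And>z. z \<in> prob_simplex n \<Longrightarrow> f z \<le> 1" "p \<in> index_pairs n" "x \<in> prob_simplex n"
  shows "resample p f x \<le> 1"
  using resample_mono[of n f "\<lambda>_. 1" p x] assms by simp

lemma seq_op_le_1:
  assumes "\<And>z. z \<in> prob_simplex n \<Longrightarrow> f z \<le> 1" "set ps \<subseteq> index_pairs n" "x \<in> prob_simplex n"
  shows "seq_op ps f x \<le> 1"
  using assms(2,3) by (induction ps arbitrary: x) (auto intro!: resample_le_1[of n] assms(1))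

text \<open>
  By induction over the sequence of pairs. When both coordinates already lie in one class of
  the remaining list, the two copies use the same \<open>l\<close>; otherwise this is the last step at
  which the two classes exchange mass, and the copies are coupled such that both classes
  receive equal mass. At the end all classes are singletons and the copies coincide. The
  inequality between values of \<open>seq_op\<close> is the form in which the coupling is used later: a
  test function at the second copy exceeds the one at the first by at most the failure
  probability.
\<close>

lemma fixed_sequence_coupling:
  assumes f: "f \<in> borel_measurable (simplex_space n)" and f1: "\<And>z. z \<in> prob_simplex n \<Longrightarrow> f z \<le> 1"
    and e: "0 < e" and ps: "set ps \<subseteq> index_pairs n"
    and "x \<in> prob_simplex n" "y \<in> prob_simplex n" "aligned n (merge_label ps) e x y"
  shows "seq_op ps f y \<le> seq_op ps f x + split_cost e ps y"
  using ps assms(5-7)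
proof (induction ps arbitrary: x y)
  case Nil
  have "x k = y k" for k
  proof (cases "k \<in> {1..n}")
    case True
    then have "fibre n (merge_label []) k = {k}" by (auto simp: fibre_def)
    moreover have "(\<Sum>k'\<in>fibre n (merge_label []) k. x k' - y k') = 0"
      using Nil.prems(4) unfolding aligned_def by blast
    ultimately show ?thesis by simp
  next
    case False
    then show ?thesis using Nil.prems(2,3) by (auto simp: prob_simplex_def extensional_def)
  qed
  then have "x = y" by (rule ext)
  then show ?case by simp
next
  case (Cons p ps)
  let ?F = "seq_op ps f" and ?V = "split_cost e ps" and ?L = "merge_label ps"
  obtain i j where pij: "p = (i, j)" by (cases p)
  from Cons.prems(1) have p: "p \<in> index_pairs n" and ps: "set ps \<subseteq> index_pairs n" by auto
  have ij: "i \<in> {1..n}" "j \<in> {1..n}" "i \<noteq> j" using p by (auto simp: pij index_pairs_def)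
  note x = Cons.prems(2) and y = Cons.prems(3)
  have al: "aligned n (merge_classes ?L i j) e x y" using Cons.prems(4) by (simp add: pij)
  have in_simplex: "gibbs_update i j l z \<in> prob_simplex n" if "z \<in> prob_simplex n" "l \<in> {0..1}" for l z
    using upd_in_simplex[OF that(1) p that(2)] by (simp add: pij)
  note F = measurable_seq_op[OF f ps] and V = measurable_split_cost[OF ps, of e]
  have F1: "?F z \<le> 1" if "z \<in> prob_simplex n" for z
    using seq_op_le_1[OF f1 ps that] .
  have comp: "(\<lambda>l. G (gibbs_update i j l z)) \<in> borel_measurable unit_law"
    if "G \<in> borel_measurable (simplex_space n)" "z \<in> prob_simplex n" for G :: "(nat \<Rightarrow> real) \<Rightarrow> ennreal" and z
    using measurable_comp_upd[OF that(1) p that(2)] by (simp add: pij)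
  show ?case
  proof (cases "?L i = ?L j")
    case True
    then have "merge_classes ?L i j = ?L" by (auto simp: merge_classes_def)
    then have al': "aligned n ?L e x y" using al by simp
    have "(\<integral>\<^sup>+ l. ?F (gibbs_update i j l y) \<partial>unit_law)
        \<le> (\<integral>\<^sup>+ l. ?F (gibbs_update i j l x) + ?V (gibbs_update i j l y) \<partial>unit_law)"
    proof (rule nn_integral_mono)
      fix l assume "l \<in> space unit_law"
      then have l: "l \<in> {0..1}" by simp
      show "?F (gibbs_update i j l y) \<le> ?F (gibbs_update i j l x) + ?V (gibbs_update i j l y)"
        by (rule Cons.IH[OF ps in_simplex[OF x l] in_simplex[OF y l]
              aligned_update_same[OF ij True al' l]])
    qed
    also have "\<dots> = resample p ?F x + resample p ?V y"
      using comp[OF F x] comp[OF V y] by (simp add: nn_integral_add resample_def pij)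
    finally have "resample p ?F y \<le> resample p ?F x + resample p ?V y"
      by (simp add: resample_def pij)
    then show ?thesis by (simp add: add.assoc[symmetric] add_increasing2)
  next
    case False
    define A where "A = fibre n ?L (?L i) - {i}"
    define B where "B = fibre n ?L (?L j) - {j}"
    define D where "D k = x k - y k" for k
    define sx where "sx = x i + x j"
    define sy where "sy = y i + y j"
    define d where "d = - sum D A"
    note h = aligned_mergeD[OF ij(1,2) False al, folded D_def A_def B_def]
    have absA: "\<bar>sum D A\<bar> \<le> (\<Sum>k\<in>A. \<bar>D k\<bar>)" and absB: "\<bar>sum D B\<bar> \<le> (\<Sum>k\<in>B. \<bar>D k\<bar>)"
      by (rule sum_abs)+
    have sxy: "sx - sy = D i + D j" by (simp add: sx_def sy_def D_def)
    have sx0: "0 \<le> sx" and sy0: "0 \<le> sy"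
      using x y ij by (auto simp: sx_def sy_def prob_simplex_def)
    have "resample p ?F y \<le> resample p ?F x + resample p ?V y + ennreal e / ennreal sy"
    \<comment> \<open>If the pair carries mass at most \<open>e\<close> in the second copy, the charge is at least 1, and nothing has to be coupled.\<close>
    proof (cases "sy \<le> e")
      case True
      have "1 \<le> ennreal e / ennreal sy"
      proof (cases "sy = 0")
        case True
        then show ?thesis using e by (simp add: divide_ennreal_def ennreal_mult_top)
      next
        case False
        then show ?thesis using sy0 e \<open>sy \<le> e\<close> by (simp add: divide_ennreal)
      qed
      then have "resample p ?F y \<le> ennreal e / ennreal sy"
        using resample_le_1[OF F1 p y] by (rule order_trans[rotated])
      then show ?thesis by (simp add: add_increasing)
    next
      case False': False
      then have sy: "0 < sy" using e by simp
      \<comment> \<open>The distance within the class is at most \<open>e < sy\<close>, so the pair has positive mass in both copies.\<close>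
      have "\<bar>sx - sy\<bar> \<le> e" using h(2) absA absB unfolding sxy by (smt (verit) sum_abs_ge_zero)
      then have sx: "0 < sx" using False' by linarith
      have fail: "max 0 (- d) + max 0 (sy + d - sx) + max 0 (sx - sy) \<le> e"
      proof -
        have "sy + d - sx = sum D B" using h(1) sxy by (simp add: d_def)
        moreover have "max 0 (- d) \<le> (\<Sum>k\<in>A. \<bar>D k\<bar>)" using absA unfolding d_def by linarith
        moreover have "max 0 (sum D B) \<le> (\<Sum>k\<in>B. \<bar>D k\<bar>)" using absB by linarith
        moreover have "max 0 (sx - sy) \<le> \<bar>D i\<bar> + \<bar>D j\<bar>" unfolding sxy by simp
        ultimately show ?thesis using h(2) by linarith
      qed
      have "(\<integral>\<^sup>+ l. ?F (gibbs_update i j l y) \<partial>unit_law)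
          \<le> (\<integral>\<^sup>+ l. ?F (gibbs_update i j l x) \<partial>unit_law) + (\<integral>\<^sup>+ l. ?V (gibbs_update i j l y) \<partial>unit_law)
            + ennreal ((max 0 (- d) + max 0 (sy + d - sx) + max 0 (sx - sy)) / sy)"
      proof (rule shifted_uniform_comparison[OF comp[OF F x] comp[OF F y] comp[OF V y] _ _ sx sy])
        fix l m assume l: "l \<in> {0..1::real}" and m: "m \<in> {0..1::real}" and "m * sx = l * sy + d"
        then have "m * (x i + x j) = l * (y i + y j) - (\<Sum>k\<in>fibre n ?L (?L i) - {i}. x k - y k)"
          by (simp add: sx_def sy_def d_def A_def D_def)
        from Cons.IH[OF ps in_simplex[OF x m] in_simplex[OF y l] aligned_update_split[OF ij(1,2) False al this]]
        show "?F (gibbs_update i j l y) \<le> ?F (gibbs_update i j m x) + ?V (gibbs_update i j l y)" .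
      qed (rule F1, rule in_simplex, rule x y, assumption)+
      also have "ennreal ((max 0 (- d) + max 0 (sy + d - sx) + max 0 (sx - sy)) / sy) \<le> ennreal (e / sy)"
        using fail sy by (intro ennreal_leI divide_right_mono) auto
      also have "ennreal (e / sy) = ennreal e / ennreal sy"
        using e sy by (simp add: divide_ennreal)
      finally show ?thesis by (simp add: resample_def pij add_left_mono)
    qed
    then show ?thesis by (simp add: pij sy_def add.assoc)
  qed
qed

text \<open>
  The uniform distribution is invariant under each single resampling, so every step
  contributes its stationary mean.
\<close>

lemma nn_integral_split_cost:
  assumes n: "n \<ge> 2" and "set ps \<subseteq> index_pairs n"
  shows "(\<integral>\<^sup>+ y. split_cost e ps y \<partial>simplex_uniform n) \<le> of_nat (length ps) * (ennreal e * ennreal (real n - 1))"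
  using assms(2)
proof (induction ps)
  case (Cons p ps)
  then have p: "p \<in> index_pairs n" and ps: "set ps \<subseteq> index_pairs n" by auto
  note cong = measurable_cong_sets[OF sets_simplex_uniform refl]
  have "(\<integral>\<^sup>+ y. split_cost e (p # ps) y \<partial>simplex_uniform n)
      = (\<integral>\<^sup>+ y. resample p (split_cost e ps) y \<partial>simplex_uniform n)
        + (\<integral>\<^sup>+ y. ennreal e / ennreal (y (fst p) + y (snd p)) \<partial>simplex_uniform n)"
    unfolding split_cost.simps
    by (rule nn_integral_add; unfold cong)
      (rule measurable_resample[OF measurable_split_cost[OF ps] p] measurable_inverse_pair_sum[OF p])+
  also have "(\<integral>\<^sup>+ y. resample p (split_cost e ps) y \<partial>simplex_uniform n)
      = (\<integral>\<^sup>+ y. split_cost e ps y \<partial>simplex_uniform n)"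
    by (rule nn_integral_simplex_uniform_resample[OF n p measurable_split_cost[OF ps]])
  also have "(\<integral>\<^sup>+ y. ennreal e / ennreal (y (fst p) + y (snd p)) \<partial>simplex_uniform n)
      = ennreal e * (\<integral>\<^sup>+ y. 1 / ennreal (y (fst p) + y (snd p)) \<partial>simplex_uniform n)"
  proof -
    have "(\<lambda>y. 1 / ennreal (y (fst p) + y (snd p))) \<in> borel_measurable (simplex_uniform n)"
      unfolding cong by (rule measurable_inverse_pair_sum[OF p])
    from nn_integral_cmult[OF this, of "ennreal e"] show ?thesis
      by (simp only: ennreal_times_divide mult_1_right)
  qed
  also have "(\<integral>\<^sup>+ y. split_cost e ps y \<partial>simplex_uniform n)
      + ennreal e * (\<integral>\<^sup>+ y. 1 / ennreal (y (fst p) + y (snd p)) \<partial>simplex_uniform n)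
      \<le> of_nat (length ps) * (ennreal e * ennreal (real n - 1)) + ennreal e * ennreal (real n - 1)"
    by (intro add_mono Cons.IH[OF ps] mult_left_mono nn_integral_inverse_pair_sum[OF n p]) simp
  finally show ?case by (simp add: distrib_right add.commute)
qed simp

section \<open>Random sequences of pairs and connectivity\<close>

lemma sum_index_pairs_symmetric:
  fixes h :: "nat \<Rightarrow> nat \<Rightarrow> real"
  assumes sym: "\<And>i j. h i j = h j i"
  shows "2 * (\<Sum>p\<in>index_pairs n. h (fst p) (snd p))
    = (\<Sum>i\<in>{1..n}. \<Sum>j\<in>{1..n}. h i j) - (\<Sum>i\<in>{1..n}. h i i)"
proof -
  let ?P = "index_pairs n" and ?g = "\<lambda>p. h (fst p) (snd p)" and ?D = "(\<lambda>i. (i, i)) ` {1..n}"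
  have split: "{1..n} \<times> {1..n} = ?P \<union> prod.swap ` ?P \<union> ?D"
  proof (intro set_eqI iffI)
    fix p assume "p \<in> {1..n} \<times> {1..n}"
    then obtain i j where p: "p = (i, j)" "i \<in> {1..n}" "j \<in> {1..n}" by blast
    consider "i < j" | "j < i" | "i = j" by linarith
    then show "p \<in> ?P \<union> prod.swap ` ?P \<union> ?D"
    proof cases
      case 2
      then have "(j, i) \<in> ?P" "p = prod.swap (j, i)" using p by (auto simp: index_pairs_def)
      then show ?thesis by blast
    qed (use p in \<open>auto simp: index_pairs_def\<close>)
  qed (auto simp: index_pairs_def)
  have disjoint: "?P \<inter> prod.swap ` ?P = {}" "(?P \<union> prod.swap ` ?P) \<inter> ?D = {}"
    by (auto simp: index_pairs_def)
  have "(\<Sum>i\<in>{1..n}. \<Sum>j\<in>{1..n}. h i j) = sum ?g ({1..n} \<times> {1..n})"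
    by (simp add: sum.cartesian_product case_prod_beta')
  also have "\<dots> = sum ?g (?P \<union> prod.swap ` ?P) + sum ?g ?D"
    unfolding split by (rule sum.union_disjoint) (use finite_index_pairs disjoint in auto)
  also have "sum ?g (?P \<union> prod.swap ` ?P) = sum ?g ?P + sum ?g (prod.swap ` ?P)"
    by (rule sum.union_disjoint) (use finite_index_pairs disjoint in auto)
  also have "sum ?g (prod.swap ` ?P) = sum ?g ?P"
    by (subst sum.reindex) (auto intro: sum.cong sym)
  also have "sum ?g ?D = (\<Sum>i\<in>{1..n}. h i i)"
    by (subst sum.reindex) (auto simp: inj_on_def)
  finally show ?thesis by simp
qed

lemma card_index_pairs: "real (card (index_pairs n)) = real n * (real n - 1) / 2"
  using sum_index_pairs_symmetric[of "\<lambda>_ _. 1" n] by (simp add: algebra_simps)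

definition crossing_pairs :: "nat \<Rightarrow> nat set \<Rightarrow> (nat \<times> nat) set" where
  "crossing_pairs n S = {p \<in> index_pairs n. (fst p \<in> S) \<noteq> (snd p \<in> S)}"

lemma card_crossing_pairs:
  assumes S: "S \<subseteq> {1..n}"
  shows "real (card (crossing_pairs n S)) = real (card S) * (real n - real (card S))"
proof -
  let ?h = "\<lambda>i j. of_bool ((i \<in> S) \<noteq> (j \<in> S)) :: real"
  have fin: "finite S" using S finite_subset by blast
  have cS: "real (card ({1..n} - S)) = real n - real (card S)"
    using card_Diff_subset[OF fin S] card_mono[OF _ S] by (simp add: of_nat_diff)
  have "real (card (crossing_pairs n S)) = (\<Sum>p\<in>index_pairs n. ?h (fst p) (snd p))"
    unfolding crossing_pairs_def by (simp add: sum.If_cases finite_index_pairs of_bool_def Int_def)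
  moreover have "2 * (\<Sum>p\<in>index_pairs n. ?h (fst p) (snd p)) = (\<Sum>i\<in>{1..n}. \<Sum>j\<in>{1..n}. ?h i j)"
    by (subst sum_index_pairs_symmetric) auto
  moreover have "(\<Sum>j\<in>{1..n}. ?h i j) = (if i \<in> S then real n - real (card S) else real (card S))" for i
  proof (cases "i \<in> S")
    case True
    have "(\<Sum>j\<in>{1..n}. ?h i j) = real (card ({1..n} - S))"
      using True by (simp add: of_bool_def sum.If_cases Diff_eq Compl_eq)
    then show ?thesis using True cS by simp
  next
    case False
    have "(\<Sum>j\<in>{1..n}. ?h i j) = real (card ({1..n} \<inter> S))"
      using False by (simp add: of_bool_def sum.If_cases)
    then show ?thesis using False S by (simp add: Int_absorb1)
  qed
  moreover have "(\<Sum>i\<in>{1..n}. if i \<in> S then real n - real (card S) else real (card S))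
      = 2 * (real (card S) * (real n - real (card S)))"
  proof -
    have "{1..n} \<inter> {i. i \<in> S} = S" "{1..n} \<inter> - {i. i \<in> S} = {1..n} - S" using S by auto
    then show ?thesis using cS by (simp add: sum.If_cases)
  qed
  ultimately show ?thesis by simp
qed

text \<open>
  The mean over \<open>m\<close> independent uniform pairs, by recursion on the first pair because \<open>seq_op\<close>
  unfolds its list in the same order.
\<close>

primrec avg_seq :: "nat \<Rightarrow> nat \<Rightarrow> ((nat \<times> nat) list \<Rightarrow> ennreal) \<Rightarrow> ennreal" where
  "avg_seq n 0 h = h []"
| "avg_seq n (Suc m) h = (\<integral>\<^sup>+ p. avg_seq n m (\<lambda>ps. h (p # ps)) \<partial>pair_law n)"

lemma avg_seq_mono:
  assumes "\<And>ps. length ps = m \<Longrightarrow> set ps \<subseteq> index_pairs n \<Longrightarrow> h ps \<le> g ps"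
  shows "avg_seq n m h \<le> avg_seq n m g"
  using assms
proof (induction m arbitrary: h g)
  case (Suc m)
  show ?case unfolding avg_seq.simps
    by (rule nn_integral_mono, rule Suc.IH, rule Suc.prems) auto
qed simp

lemma avg_seq_add: "avg_seq n m (\<lambda>ps. h ps + g ps) = avg_seq n m h + avg_seq n m g"
  by (induction m arbitrary: h g) (simp_all add: nn_integral_add)

lemma avg_seq_const: "n \<ge> 2 \<Longrightarrow> avg_seq n m (\<lambda>_. c) = c"
  by (induction m) (simp_all only: avg_seq.simps nn_integral_pair_law_const)

lemma avg_seq_sum: "finite I \<Longrightarrow> avg_seq n m (\<lambda>ps. \<Sum>i\<in>I. h i ps) = (\<Sum>i\<in>I. avg_seq n m (h i))"
proof (induction I rule: finite_induct)
  case empty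
  have "avg_seq n m (\<lambda>_. 0) = 0" by (induction m) simp_all
  then show ?case by simp
qed (simp add: avg_seq_add)

lemma measurable_avg_seq:
  assumes "\<And>ps. set ps \<subseteq> index_pairs n \<Longrightarrow> h ps \<in> borel_measurable M"
  shows "(\<lambda>x. avg_seq n m (\<lambda>ps. h ps x)) \<in> borel_measurable M"
  using assms
proof (induction m arbitrary: h)
  case (Suc m)
  show ?case unfolding avg_seq.simps nn_integral_pair_law
    by (intro borel_measurable_sum borel_measurable_times_ennreal Suc.IH Suc.prems) auto
qed simp

lemma avg_seq_nn_integral:
  assumes "\<And>ps. set ps \<subseteq> index_pairs n \<Longrightarrow> h ps \<in> borel_measurable M"
  shows "avg_seq n m (\<lambda>ps. \<integral>\<^sup>+ x. h ps x \<partial>M) = (\<integral>\<^sup>+ x. avg_seq n m (\<lambda>ps. h ps x) \<partial>M)"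
  using assms
proof (induction m arbitrary: h)
  case (Suc m)
  have m: "(\<lambda>x. avg_seq n m (\<lambda>ps. h (p # ps) x)) \<in> borel_measurable M" if "p \<in> index_pairs n" for p
    using that by (intro measurable_avg_seq Suc.prems) auto
  have "avg_seq n (Suc m) (\<lambda>ps. \<integral>\<^sup>+ x. h ps x \<partial>M)
      = (\<integral>\<^sup>+ p. \<integral>\<^sup>+ x. avg_seq n m (\<lambda>ps. h (p # ps) x) \<partial>M \<partial>pair_law n)"
    unfolding avg_seq.simps by (intro nn_integral_cong Suc.IH Suc.prems) auto
  also have "\<dots> = (\<integral>\<^sup>+ x. avg_seq n (Suc m) (\<lambda>ps. h ps x) \<partial>M)"
    unfolding avg_seq.simps nn_integral_pair_law
    using m by (simp add: nn_integral_sum nn_integral_multc borel_measurable_times_ennreal)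
  finally show ?case .
qed simp

lemma gibbs_op_pow_eq_avg_seq:
  assumes f: "f \<in> borel_measurable (simplex_space n)" and x: "x \<in> prob_simplex n"
  shows "(gibbs_op n ^^ m) f x = avg_seq n m (\<lambda>ps. seq_op ps f x)"
  using x
proof (induction m arbitrary: x)
  case (Suc m)
  have "(gibbs_op n ^^ Suc m) f x = gibbs_op n (\<lambda>z. avg_seq n m (\<lambda>ps. seq_op ps f z)) x"
    using Suc.prems by (auto intro!: gibbs_op_cong[of n] Suc.IH)
  also have "\<dots> = (\<integral>\<^sup>+ p. avg_seq n m (\<lambda>ps. seq_op (p # ps) f x) \<partial>pair_law n)"
    unfolding gibbs_op_def resample_def seq_op.simps
    by (intro nn_integral_cong avg_seq_nn_integral[symmetric] measurable_comp_upd[OF measurable_seq_op[OF f]])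
       (use Suc.prems in auto)
  finally show ?case by simp
qed simp

lemma avg_seq_avoid:
  assumes n: "n \<ge> 2" and E: "E \<subseteq> index_pairs n"
  shows "avg_seq n m (\<lambda>ps. of_bool (set ps \<inter> E = {})) = ennreal ((1 - card E / card (index_pairs n)) ^ m)"
proof (induction m)
  case (Suc m)
  let ?N = "real (card (index_pairs n))" and ?q = "1 - card E / card (index_pairs n)"
  have N: "0 < ?N"
    using index_pairs_nonempty[OF n] finite_index_pairs[of n] by (simp add: card_gt_0_iff)
  have cE: "card E \<le> card (index_pairs n)" by (rule card_mono[OF finite_index_pairs E])
  then have q: "0 \<le> ?q" using N by (simp add: divide_le_eq)
  have "avg_seq n m (\<lambda>ps. of_bool (set (p # ps) \<inter> E = {})) = of_bool (p \<notin> E) * ennreal (?q ^ m)" for p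
    using Suc avg_seq_const[OF n, of m 0] by (cases "p \<in> E") auto
  then have "avg_seq n (Suc m) (\<lambda>ps. of_bool (set ps \<inter> E = {}))
      = (\<Sum>p\<in>index_pairs n. of_bool (p \<notin> E) * (ennreal (?q ^ m) * ennreal (1 / ?N)))"
    unfolding avg_seq.simps nn_integral_pair_law by (simp add: mult.assoc)
  also have "\<dots> = of_nat (card (index_pairs n - E)) * (ennreal (?q ^ m) * ennreal (1 / ?N))"
    unfolding sum_distrib_right[symmetric]
    by (simp add: of_bool_def sum.If_cases finite_index_pairs Diff_eq Compl_eq)
  also have "\<dots> = ennreal (real (card (index_pairs n - E)) * (?q ^ m * (1 / ?N)))"
    using zero_le_power[OF q, of m] N
    by (simp only: ennreal_mult ennreal_of_nat_eq_real_of_nat of_nat_0_le_iff mult_nonneg_nonneg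
        zero_le_divide_1_iff less_imp_le)
  also have "real (card (index_pairs n - E)) = ?N - card E"
    using card_Diff_subset[OF finite_subset[OF E finite_index_pairs] E] cE by (simp add: of_nat_diff)
  also have "(?N - card E) * (?q ^ m * (1 / ?N)) = ?q ^ Suc m"
    using N by (simp add: field_simps)
  finally show ?case .
qed simp

definition disconnected :: "nat \<Rightarrow> (nat \<times> nat) list \<Rightarrow> bool" where
  "disconnected n ps \<longleftrightarrow> (\<exists>k\<in>{1..n}. merge_label ps k \<noteq> merge_label ps 1)"

lemma merge_label_edge: "p \<in> set ps \<Longrightarrow> merge_label ps (fst p) = merge_label ps (snd p)"
  by (induction ps) (auto simp: merge_classes_def)

lemma disconnected_uncrossed_set:
  assumes n: "n \<ge> 1" and d: "disconnected n ps"
  obtains S where "S \<subseteq> {1..n}" "S \<noteq> {}" "2 * card S \<le> n" "set ps \<inter> crossing_pairs n S = {}"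
proof -
  define T where "T = fibre n (merge_label ps) (merge_label ps 1)"
  have T: "T \<subseteq> {1..n}" "1 \<in> T" using n by (auto simp: T_def fibre_def)
  have nT: "{1..n} - T \<noteq> {}" using d by (auto simp: T_def fibre_def disconnected_def)
  have c: "set ps \<inter> crossing_pairs n T = {}" "set ps \<inter> crossing_pairs n ({1..n} - T) = {}"
    using merge_label_edge[of _ ps] by (auto simp: crossing_pairs_def T_def fibre_def index_pairs_def)
  have "card ({1..n} - T) = n - card T" using T by (simp add: card_Diff_subset finite_subset)
  then have "2 * card T \<le> n \<or> 2 * card ({1..n} - T) \<le> n" by linarith
  then show ?thesis
    using that[of T] that[of "{1..n} - T"] T nT c by blast
qed

text \<open>
  If the pairs do not connect all vertices, some set \<open>S\<close> of at most half of them is crossed by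
  no pair. A random pair crosses \<open>S\<close> with probability at least \<open>card S / n\<close>, so \<open>S\<close> stays
  uncrossed with probability at most \<open>q ^ card S\<close>, where \<open>q = exp (- m / n)\<close>. Summing over all
  nonempty sets gives \<open>(1 + q) ^ n - 1\<close> by the binomial theorem.
\<close>

lemma avg_seq_disconnected:
  assumes n: "n \<ge> 2"
  shows "avg_seq n m (\<lambda>ps. of_bool (disconnected n ps)) \<le> ennreal ((1 + exp (- real m / real n)) ^ n - 1)"
proof -
  define \<S> where "\<S> = {S. S \<subseteq> {1..n} \<and> S \<noteq> {} \<and> 2 * card S \<le> n}"
  let ?q = "exp (- real m / real n)"
  have fin: "finite \<S>" by (rule finite_subset[of _ "Pow {1..n}"]) (auto simp: \<S>_def)
  have "avg_seq n m (\<lambda>ps. of_bool (disconnected n ps))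
      \<le> avg_seq n m (\<lambda>ps. \<Sum>S\<in>\<S>. of_bool (set ps \<inter> crossing_pairs n S = {}))"
  proof (rule avg_seq_mono)
    fix ps
    show "of_bool (disconnected n ps) \<le> (\<Sum>S\<in>\<S>. of_bool (set ps \<inter> crossing_pairs n S = {}) :: ennreal)"
    proof (cases "disconnected n ps")
      case True
      have "1 \<le> n" using n by simp
      from disconnected_uncrossed_set[OF this True] obtain S
        where "S \<subseteq> {1..n}" "S \<noteq> {}" "2 * card S \<le> n" and S2: "set ps \<inter> crossing_pairs n S = {}" .
      then have S1: "S \<in> \<S>" by (simp add: \<S>_def)
      have "of_bool (set ps \<inter> crossing_pairs n S = {}) \<le> (\<Sum>S\<in>\<S>. of_bool (set ps \<inter> crossing_pairs n S = {}) :: ennreal)"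
        by (rule member_le_sum[OF S1 _ fin]) simp
      then show ?thesis using True S2 by simp
    qed simp
  qed
  also have "\<dots> = (\<Sum>S\<in>\<S>. avg_seq n m (\<lambda>ps. of_bool (set ps \<inter> crossing_pairs n S = {})))"
    by (rule avg_seq_sum[OF fin])
  also have "\<dots> \<le> (\<Sum>S\<in>\<S>. ennreal (?q ^ card S))"
  proof (rule sum_mono)
    fix S assume "S \<in> \<S>"
    then have S: "S \<subseteq> {1..n}" "2 * card S \<le> n" by (auto simp: \<S>_def)
    let ?u = "card (crossing_pairs n S) / card (index_pairs n)"
    have cE: "card (crossing_pairs n S) \<le> card (index_pairs n)"
      by (rule card_mono[OF finite_index_pairs]) (auto simp: crossing_pairs_def)
    have N: "0 < real (card (index_pairs n))"
      using index_pairs_nonempty[OF n] finite_index_pairs[of n] by (simp add: card_gt_0_iff)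
    have u1: "?u \<le> 1" using cE N by (simp add: divide_le_eq)
    have "card S / n \<le> ?u"
    proof -
      have "real (card S) * (real n - 1) \<le> 2 * (real (card S) * (real n - real (card S)))"
      proof -
        have "real (2 * card S) \<le> real n" using S(2) by (simp only: of_nat_le_iff)
        then have "real n - 1 \<le> 2 * (real n - real (card S))" by simp
        from mult_left_mono[OF this, of "real (card S)"] show ?thesis by (simp add: algebra_simps)
      qed
      from divide_right_mono[OF this, of "real n * (real n - 1)"] n show ?thesis
        unfolding card_crossing_pairs[OF S(1)] card_index_pairs by (simp add: mult.commute)
    qed
    then have "1 - ?u \<le> exp (- (card S / n))"
      using exp_ge_add_one_self[of "- (card S / n)"] by linarith
    then have "(1 - ?u) ^ m \<le> exp (- (card S / n)) ^ m" using u1 by (intro power_mono) auto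
    also have "\<dots> = ?q ^ card S"
      by (simp flip: exp_of_nat_mult add: mult.commute)
    finally have "(1 - ?u) ^ m \<le> ?q ^ card S" .
    then show "avg_seq n m (\<lambda>ps. of_bool (set ps \<inter> crossing_pairs n S = {})) \<le> ennreal (?q ^ card S)"
      by (subst avg_seq_avoid[OF n]) (auto simp: crossing_pairs_def intro: ennreal_leI)
  qed
  also have "\<dots> = ennreal (\<Sum>S\<in>\<S>. ?q ^ card S)"
    by (rule sum_ennreal) simp
  also have "\<dots> \<le> ennreal ((1 + ?q) ^ n - 1)"
  proof (rule ennreal_leI)
    have "(1 + ?q) ^ n = (\<Prod>k\<in>{1..n}. ?q + 1)" by (simp add: add.commute)
    also have "\<dots> = (\<Sum>S\<in>Pow {1..n}. ?q ^ card S)" by (subst prod_add) simp_all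
    also have "\<dots> = 1 + (\<Sum>S\<in>Pow {1..n} - {{}}. ?q ^ card S)"
      by (subst sum.remove[of _ "{}"]) auto
    finally have "(1 + ?q) ^ n = 1 + (\<Sum>S\<in>Pow {1..n} - {{}}. ?q ^ card S)" .
    moreover have "(\<Sum>S\<in>\<S>. ?q ^ card S) \<le> (\<Sum>S\<in>Pow {1..n} - {{}}. ?q ^ card S)"
      by (rule sum_mono2) (auto simp: \<S>_def)
    ultimately show "(\<Sum>S\<in>\<S>. ?q ^ card S) \<le> (1 + ?q) ^ n - 1" by linarith
  qed
  finally show ?thesis .
qed

lemma aligned_if_connected:
  assumes x: "x \<in> prob_simplex n" and y: "y \<in> prob_simplex n" and e: "0 < e"
    and close: "(\<Sum>k\<in>{1..n}. \<bar>x k - y k\<bar>) \<le> e" and c: "\<not> disconnected n ps"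
  shows "aligned n (merge_label ps) e x y"
  unfolding aligned_def
proof
  fix c
  obtain b where label: "\<And>k. k \<in> {1..n} \<Longrightarrow> merge_label ps k = b"
    using c unfolding disconnected_def by blast
  have fibre: "fibre n (merge_label ps) c = {k \<in> {1..n}. b = c}"
    unfolding fibre_def by (intro Collect_cong conj_cong refl) (simp only: label)
  have zero: "(\<Sum>k\<in>{1..n}. x k - y k) = 0"
    using x y by (simp add: sum_subtractf prob_simplex_def)
  show "(\<Sum>k\<in>fibre n (merge_label ps) c. x k - y k) = 0 \<and>
      (\<Sum>k\<in>fibre n (merge_label ps) c. \<bar>x k - y k\<bar>) \<le> e"
  proof (cases "c = b")
    case True
    then have "fibre n (merge_label ps) c = {1..n}" unfolding fibre by auto
    then show ?thesis using zero close by (simp only:)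
  next
    case False
    then have "fibre n (merge_label ps) c = {}" unfolding fibre by simp
    then show ?thesis using e by simp
  qed
qed

lemma close_points_coupling:
  assumes f: "f \<in> borel_measurable (simplex_space n)" and f1: "\<And>z. z \<in> prob_simplex n \<Longrightarrow> f z \<le> 1"
    and e: "0 < e" and x: "x \<in> prob_simplex n" and y: "y \<in> prob_simplex n"
    and close: "(\<Sum>k\<in>{1..n}. \<bar>x k - y k\<bar>) \<le> e"
  shows "(gibbs_op n ^^ m) f y \<le> (gibbs_op n ^^ m) f x
    + (avg_seq n m (\<lambda>ps. split_cost e ps y) + avg_seq n m (\<lambda>ps. of_bool (disconnected n ps)))"
proof -
  have "avg_seq n m (\<lambda>ps. seq_op ps f y)
      \<le> avg_seq n m (\<lambda>ps. seq_op ps f x + (split_cost e ps y + of_bool (disconnected n ps)))"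
  proof (rule avg_seq_mono)
    fix ps assume ps: "set ps \<subseteq> index_pairs n"
    show "seq_op ps f y \<le> seq_op ps f x + (split_cost e ps y + of_bool (disconnected n ps))"
    proof (cases "disconnected n ps")
      case True
      then show ?thesis
        using seq_op_le_1[OF f1 ps y] by (simp add: add_increasing)
    next
      case False
      then show ?thesis
        using fixed_sequence_coupling[OF f f1 e ps x y aligned_if_connected[OF x y e close False]] by simp
    qed
  qed
  then show ?thesis
    unfolding gibbs_op_pow_eq_avg_seq[OF f x] gibbs_op_pow_eq_avg_seq[OF f y] avg_seq_add .
qed

section \<open>Contraction of the squared distance\<close>

definition sq_dist :: "nat \<Rightarrow> (nat \<Rightarrow> real) \<Rightarrow> (nat \<Rightarrow> real) \<Rightarrow> real" where
  "sq_dist n x y = (\<Sum>k\<in>{1..n}. (x k - y k)\<^sup>2)"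

lemma sq_dist_nonneg: "0 \<le> sq_dist n x y"
  by (simp add: sq_dist_def sum_nonneg)

lemma sq_dist_le_2:
  assumes "x \<in> prob_simplex n" "y \<in> prob_simplex n"
  shows "sq_dist n x y \<le> 2"
proof -
  have le1: "z k \<le> 1" if "z \<in> prob_simplex n" "k \<in> {1..n}" for z k
    using member_le_sum[of k "{1..n}" z] that by (auto simp: prob_simplex_def)
  have "(x k - y k)\<^sup>2 \<le> x k + y k" if k: "k \<in> {1..n}" for k
  proof -
    have *: "0 \<le> x k" "0 \<le> y k" "x k \<le> 1" "y k \<le> 1"
      using assms k le1 by (auto simp: prob_simplex_def)
    then have "x k * x k \<le> x k" "y k * y k \<le> y k" "0 \<le> x k * y k"
      by (auto intro: mult_left_le)
    then show ?thesis by (simp add: power2_eq_square algebra_simps)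
  qed
  then have "sq_dist n x y \<le> (\<Sum>k\<in>{1..n}. x k + y k)"
    unfolding sq_dist_def by (rule sum_mono)
  also have "\<dots> = 2" using assms by (simp add: sum.distrib prob_simplex_def)
  finally show ?thesis .
qed

lemma sq_dist_update:
  assumes "i \<in> {1..n}" "j \<in> {1..n}" "i \<noteq> j"
  shows "sq_dist n (gibbs_update i j l x) (gibbs_update i j l y)
    = sq_dist n x y - ((x i - y i)\<^sup>2 + (x j - y j)\<^sup>2)
      + (l\<^sup>2 + (1 - l)\<^sup>2) * ((x i - y i) + (x j - y j))\<^sup>2"
proof -
  define R where "R = {1..n} - {i, j}"
  have S: "{1..n} = insert i (insert j R)" and R: "finite R" "i \<notin> R" "j \<notin> R"
    using assms by (auto simp: R_def)
  have split: "sum g {1..n} = g i + g j + sum g R" for g :: "nat \<Rightarrow> real"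
    unfolding S using R assms(3) by simp
  have "(\<Sum>k\<in>R. (gibbs_update i j l x k - gibbs_update i j l y k)\<^sup>2) = (\<Sum>k\<in>R. (x k - y k)\<^sup>2)"
    using R by (intro sum.cong) (auto simp: gibbs_update_def)
  then show ?thesis
    unfolding sq_dist_def split using assms(3)
    by (simp add: gibbs_update_def power2_eq_square algebra_simps)
qed

text \<open>
  The factor \<open>2 / 3\<close> is the mean of \<open>l\<^sup>2 + (1 - l)\<^sup>2\<close>.
\<close>

lemma nn_integral_sq_dist_update:
  fixes x y :: "nat \<Rightarrow> real"
  assumes p: "(i, j) \<in> index_pairs n" and \<kappa>: "0 \<le> \<kappa>"
  defines "a \<equiv> (x i - y i)\<^sup>2 + (x j - y j)\<^sup>2" and "s \<equiv> ((x i - y i) + (x j - y j))\<^sup>2"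
  shows "(\<integral>\<^sup>+ l. ennreal (\<kappa> * sq_dist n (gibbs_update i j l x) (gibbs_update i j l y)) \<partial>unit_law)
    = ennreal (\<kappa> * (sq_dist n x y - a + 2 / 3 * s))" (is "?lhs = _")
    and "0 \<le> sq_dist n x y - a + 2 / 3 * s"
    and "(\<lambda>l. ennreal (\<kappa> * sq_dist n (gibbs_update i j l x) (gibbs_update i j l y))) \<in> borel_measurable unit_law"
proof -
  have ij: "i \<in> {1..n}" "j \<in> {1..n}" "i \<noteq> j" using p by (auto simp: index_pairs_def)
  define D where "D = sq_dist n x y"
  have upd: "sq_dist n (gibbs_update i j l x) (gibbs_update i j l y) = D - a + (l\<^sup>2 + (1 - l)\<^sup>2) * s" for l
    unfolding sq_dist_update[OF ij] a_def s_def D_def ..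
  have nonneg: "0 \<le> D - a + (l\<^sup>2 + (1 - l)\<^sup>2) * s" for l
    using sq_dist_nonneg[of n "gibbs_update i j l x" "gibbs_update i j l y"] unfolding upd .
  show m: "(\<lambda>l. ennreal (\<kappa> * sq_dist n (gibbs_update i j l x) (gibbs_update i j l y))) \<in> borel_measurable unit_law"
    unfolding upd by (intro borel_measurable_unit_law) measurable
  have "?lhs = (\<integral>\<^sup>+ l. ennreal (\<kappa> * (D - a + (l\<^sup>2 + (1 - l)\<^sup>2) * s)) * indicator {0..1} l \<partial>lborel)"
    using nn_integral_unit_law[OF m] unfolding upd .
  also have "\<dots> = ennreal ((\<kappa> * ((D - a) * 1 + (1 ^ 3 / 3 - (1 - 1) ^ 3 / 3) * s))
      - (\<kappa> * ((D - a) * 0 + (0 ^ 3 / 3 - (1 - 0) ^ 3 / 3) * s)))"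
  proof (rule nn_integral_FTC_Icc)
    fix l :: real
    show "((\<lambda>l. \<kappa> * ((D - a) * l + (l ^ 3 / 3 - (1 - l) ^ 3 / 3) * s)) has_real_derivative
        \<kappa> * (D - a + (l\<^sup>2 + (1 - l)\<^sup>2) * s)) (at l)"
      by (auto intro!: derivative_eq_intros simp: field_simps power2_eq_square power3_eq_cube)
    show "0 \<le> \<kappa> * (D - a + (l\<^sup>2 + (1 - l)\<^sup>2) * s)"
      using \<kappa> nonneg by simp
  qed auto
  also have "\<dots> = ennreal (\<kappa> * (D - a + 2 / 3 * s))"
    by (simp add: algebra_simps)
  finally show "?lhs = ennreal (\<kappa> * (sq_dist n x y - a + 2 / 3 * s))" by (simp add: D_def)
  have "0 \<le> s" by (simp add: s_def)
  then show "0 \<le> sq_dist n x y - a + 2 / 3 * s"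
    using nonneg[of "1/2"] unfolding D_def by (simp add: power2_eq_square)
qed

text \<open>
  With \<open>d = x - y\<close>, the sum of \<open>(d i)\<^sup>2 + (d j)\<^sup>2\<close> over all pairs is \<open>n - 1\<close> times the squared
  distance, and since the coordinates of \<open>d\<close> add up to zero, the sum of \<open>2 * d i * d j\<close> is
  minus the squared distance. The exact contraction factor is
  \<open>1 - 2 * (n + 1) / (3 * n * (n - 1))\<close>.
\<close>

lemma sq_dist_contraction:
  assumes n: "n \<ge> 2" and x: "x \<in> prob_simplex n" and y: "y \<in> prob_simplex n" and \<kappa>: "0 \<le> \<kappa>"
  shows "(\<integral>\<^sup>+ p. \<integral>\<^sup>+ l. ennreal (\<kappa> * sq_dist n (upd p l x) (upd p l y)) \<partial>unit_law \<partial>pair_law n)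
    \<le> ennreal ((1 - 2 / (3 * real n)) * \<kappa> * sq_dist n x y)"
proof -
  let ?N = "real (card (index_pairs n))"
  define D where "D = sq_dist n x y"
  define d where "d k = x k - y k" for k
  define c where "c i j = D - ((d i)\<^sup>2 + (d j)\<^sup>2) + 2 / 3 * (d i + d j)\<^sup>2" for i j
  have N: "0 < ?N"
    using index_pairs_nonempty[OF n] finite_index_pairs[of n] by (simp add: card_gt_0_iff)
  have c0: "0 \<le> c (fst p) (snd p)" if "p \<in> index_pairs n" for p
    using nn_integral_sq_dist_update(2)[of "fst p" "snd p" n \<kappa> x y] that \<kappa>
    by (simp add: c_def d_def D_def)
  have "(\<integral>\<^sup>+ p. \<integral>\<^sup>+ l. ennreal (\<kappa> * sq_dist n (upd p l x) (upd p l y)) \<partial>unit_law \<partial>pair_law n)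
      = (\<Sum>p\<in>index_pairs n. ennreal (\<kappa> * c (fst p) (snd p) / ?N))"
    unfolding nn_integral_pair_law
  proof (rule sum.cong[OF refl])
    fix p assume p: "p \<in> index_pairs n"
    have "(\<integral>\<^sup>+ l. ennreal (\<kappa> * sq_dist n (upd p l x) (upd p l y)) \<partial>unit_law)
        = ennreal (\<kappa> * c (fst p) (snd p))"
      using nn_integral_sq_dist_update(1)[of "fst p" "snd p" n \<kappa> x y] p \<kappa>
      by (simp add: c_def d_def D_def)
    then show "(\<integral>\<^sup>+ l. ennreal (\<kappa> * sq_dist n (upd p l x) (upd p l y)) \<partial>unit_law) * ennreal (1 / ?N)
        = ennreal (\<kappa> * c (fst p) (snd p) / ?N)"
      using c0[OF p] \<kappa> by (simp flip: ennreal_mult)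
  qed
  also have "\<dots> = ennreal (\<Sum>p\<in>index_pairs n. \<kappa> * c (fst p) (snd p) / ?N)"
    using c0 \<kappa> by (intro sum_ennreal) simp
  also have "(\<Sum>p\<in>index_pairs n. \<kappa> * c (fst p) (snd p) / ?N) = \<kappa> * (\<Sum>p\<in>index_pairs n. c (fst p) (snd p)) / ?N"
    by (simp add: sum_distrib_left sum_divide_distrib)
  also have "(\<Sum>p\<in>index_pairs n. c (fst p) (snd p)) = D * (?N - (real n + 1) / 3)"
  proof -
    have sd: "(\<Sum>k\<in>{1..n}. (d k)\<^sup>2) = D" by (simp add: D_def sq_dist_def d_def)
    have s0: "(\<Sum>k\<in>{1..n}. d k) = 0"
      using x y by (simp add: d_def sum_subtractf prob_simplex_def)
    \<comment> \<open>In this form the sum over all pairs only involves the squared distance and the vanishing sum of \<open>d\<close>.\<close>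
    have c_alt: "c i j = D - 1 / 3 * ((d i)\<^sup>2 + (d j)\<^sup>2) + 4 / 3 * (d i * d j)" for i j
      by (simp add: c_def power2_eq_square algebra_simps)
    have "2 * (\<Sum>p\<in>index_pairs n. c (fst p) (snd p))
        = (\<Sum>i\<in>{1..n}. \<Sum>j\<in>{1..n}. c i j) - (\<Sum>i\<in>{1..n}. c i i)"
      by (rule sum_index_pairs_symmetric) (simp add: c_def add.commute)
    also have "(\<Sum>i\<in>{1..n}. c i i) = real n * D + 2 / 3 * D"
      unfolding c_alt by (simp add: sum.distrib sum_subtractf sd power2_eq_square[symmetric]
          del: One_nat_def flip: sum_distrib_left sum_divide_distrib)
    also have "(\<Sum>i\<in>{1..n}. \<Sum>j\<in>{1..n}. c i j) = real n * real n * D - 2 / 3 * real n * D"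
      unfolding c_alt
      by (simp add: sum.distrib sum_subtractf sd s0 del: One_nat_def flip: sum_distrib_left sum_divide_distrib)
    finally show ?thesis unfolding card_index_pairs by (simp add: field_simps)
  qed
  also have "\<kappa> * (D * (?N - (real n + 1) / 3)) / ?N \<le> (1 - 2 / (3 * real n)) * \<kappa> * D"
  proof -
    have "(?N - (real n + 1) / 3) / ?N \<le> 1 - 2 / (3 * real n)"
      unfolding card_index_pairs using n by (simp add: field_simps)
    from mult_right_mono[OF this, of "\<kappa> * D"] show ?thesis
      using \<kappa> sq_dist_nonneg[of n x y] by (simp add: D_def mult_ac)
  qed
  finally show ?thesis by (simp add: D_def ennreal_leI)
qed

lemma proportional_coupling_step:
  assumes n: "n \<ge> 2" and \<kappa>: "0 \<le> \<kappa>"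
    and g: "g \<in> borel_measurable (simplex_space n)" and V: "V \<in> borel_measurable (simplex_space n)"
    and le: "\<And>x y. x \<in> prob_simplex n \<Longrightarrow> y \<in> prob_simplex n
      \<Longrightarrow> g y \<le> g x + V y + ennreal (\<kappa> * sq_dist n x y)"
    and x: "x \<in> prob_simplex n" and y: "y \<in> prob_simplex n"
  shows "gibbs_op n g y \<le> gibbs_op n g x + gibbs_op n V y
    + ennreal ((1 - 2 / (3 * real n)) * \<kappa> * sq_dist n x y)"
proof -
  let ?E = "\<lambda>p. \<integral>\<^sup>+ l. ennreal (\<kappa> * sq_dist n (upd p l x) (upd p l y)) \<partial>unit_law"
  have "gibbs_op n g y \<le> (\<integral>\<^sup>+ p. resample p g x + resample p V y + ?E p \<partial>pair_law n)"
    unfolding gibbs_op_def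
  proof (rule nn_integral_mono)
    fix p assume "p \<in> space (pair_law n)"
    then have p: "p \<in> index_pairs n" by simp
    have m: "(\<lambda>l. ennreal (\<kappa> * sq_dist n (upd p l x) (upd p l y))) \<in> borel_measurable unit_law"
      by (rule nn_integral_sq_dist_update(3)[OF _ \<kappa>]) (simp add: p)
    note mg = measurable_comp_upd[OF g p x] and mV = measurable_comp_upd[OF V p y]
    have "resample p g y \<le> (\<integral>\<^sup>+ l. g (upd p l x) + V (upd p l y)
        + ennreal (\<kappa> * sq_dist n (upd p l x) (upd p l y)) \<partial>unit_law)"
      unfolding resample_def by (intro nn_integral_mono le upd_in_simplex x y p) simp_all
    also have "\<dots> = resample p g x + resample p V y + ?E p"
      unfolding resample_def
      by (simp only: nn_integral_add[OF borel_measurable_add[OF mg mV] m] nn_integral_add[OF mg mV])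
    finally show "resample p g y \<le> resample p g x + resample p V y + ?E p" .
  qed
  also have "\<dots> = gibbs_op n g x + gibbs_op n V y + (\<integral>\<^sup>+ p. ?E p \<partial>pair_law n)"
    unfolding gibbs_op_def by (simp only: nn_integral_add[OF measurable_pair_law measurable_pair_law])
  also have "\<dots> \<le> gibbs_op n g x + gibbs_op n V y + ennreal ((1 - 2 / (3 * real n)) * \<kappa> * sq_dist n x y)"
    by (intro add_left_mono sq_dist_contraction n x y \<kappa>)
  finally show ?thesis .
qed

text \<open>
  The first phase: both copies use the same pair and the same \<open>l\<close>. Any bound for a function
  \<open>g\<close> by a cost \<open>V\<close> of the second copy plus a multiple of the squared distance is transported
  through \<open>t\<close> steps, with the distance term contracted and \<open>V\<close> averaged.
\<close>

lemma proportional_coupling: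
  assumes n: "n \<ge> 2" and \<kappa>: "0 \<le> \<kappa>"
    and g: "g \<in> borel_measurable (simplex_space n)" and V: "V \<in> borel_measurable (simplex_space n)"
    and le: "\<And>x y. x \<in> prob_simplex n \<Longrightarrow> y \<in> prob_simplex n
      \<Longrightarrow> g y \<le> g x + V y + ennreal (\<kappa> * sq_dist n x y)"
    and x: "x \<in> prob_simplex n" and y: "y \<in> prob_simplex n"
  shows "(gibbs_op n ^^ t) g y \<le> (gibbs_op n ^^ t) g x + (gibbs_op n ^^ t) V y
    + ennreal ((1 - 2 / (3 * real n)) ^ t * \<kappa> * sq_dist n x y)"
  using x y
proof (induction t arbitrary: x y)
  case 0
  then show ?case using le by simp
next
  case (Suc t)
  let ?\<rho> = "1 - 2 / (3 * real n)"
  have \<kappa>': "0 \<le> ?\<rho> ^ t * \<kappa>" using n \<kappa> by simp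
  have "gibbs_op n ((gibbs_op n ^^ t) g) y
      \<le> gibbs_op n ((gibbs_op n ^^ t) g) x + gibbs_op n ((gibbs_op n ^^ t) V) y
        + ennreal (?\<rho> * (?\<rho> ^ t * \<kappa>) * sq_dist n x y)"
  proof (rule proportional_coupling_step[OF n \<kappa>' _ _ _ Suc.prems])
    show "(gibbs_op n ^^ t) g \<in> borel_measurable (simplex_space n)"
      "(gibbs_op n ^^ t) V \<in> borel_measurable (simplex_space n)"
      by (rule measurable_gibbs_op_pow[OF g], rule measurable_gibbs_op_pow[OF V])
  qed (rule Suc.IH)
  then show ?case by (simp only: funpow.simps o_apply power_Suc mult.assoc)
qed

lemma sum_abs_sq_le: "(\<Sum>k\<in>{1..n}. \<bar>x k - y k\<bar>)\<^sup>2 \<le> real n * sq_dist n x y"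
  using Cauchy_Schwarz_ineq_sum[of "\<lambda>_. 1" "\<lambda>k. \<bar>x k - y k\<bar>" "{1..n}"]
  by (simp add: sq_dist_def)

section \<open>The upper bound on the mixing time\<close>

text \<open>
  The three error terms bound the stationary mean of the splitting costs, the probability that
  the last \<open>m\<close> pairs do not connect all vertices, and the probability that the copies are
  further than \<open>e\<close> apart in \<open>L1\<close>-distance after the first \<open>t\<close> steps. The last one is a
  second-moment bound: where the \<open>L1\<close>-distance exceeds \<open>e\<close>, Cauchy--Schwarz makes \<open>n / e\<^sup>2\<close>
  times the squared distance at least 1. The second copy starts from the uniform distribution,
  which turns the cost \<open>V\<close> into its stationary mean.
\<close>

lemma emeasure_uniform_le_kernel:
  assumes n: "n \<ge> 2" and x: "x \<in> prob_simplex n" and A: "A \<in> sets (simplex_space n)" and e: "0 < e"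
  shows "emeasure (simplex_uniform n) A \<le> emeasure (gibbs_kernel_pow n (t + m) x) A
    + (ennreal (real m * (e * (real n - 1))) + ennreal ((1 + exp (- real m / real n)) ^ n - 1)
       + ennreal (2 * (1 - 2 / (3 * real n)) ^ t * (real n / e\<^sup>2)))"
proof -
  let ?U = "simplex_uniform n" and ?f = "indicator A :: (nat \<Rightarrow> real) \<Rightarrow> ennreal"
  let ?\<rho> = "1 - 2 / (3 * real n)" and ?\<kappa> = "real n / e\<^sup>2"
  interpret U: prob_space ?U using n by (intro prob_space_simplex_uniform) simp
  note cong = measurable_cong_sets[OF sets_simplex_uniform refl]
  have f: "?f \<in> borel_measurable (simplex_space n)" using A by simp
  have f1: "?f z \<le> 1" for z by (simp add: indicator_def)
  define g where "g = (gibbs_op n ^^ m) ?f"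
  define V1 where "V1 y = avg_seq n m (\<lambda>ps. split_cost e ps y)" for y
  define \<delta> where "\<delta> = avg_seq n m (\<lambda>ps. of_bool (disconnected n ps))"
  define V where "V y = V1 y + \<delta>" for y
  have g: "g \<in> borel_measurable (simplex_space n)"
    unfolding g_def by (rule measurable_gibbs_op_pow[OF f])
  have V1: "V1 \<in> borel_measurable (simplex_space n)"
    unfolding V1_def by (intro measurable_avg_seq measurable_split_cost)
  then have V: "V \<in> borel_measurable (simplex_space n)" unfolding V_def by simp
  have g1: "g z \<le> 1" if "z \<in> prob_simplex n" for z
    unfolding g_def gibbs_op_pow_eq_avg_seq[OF f that]
    using avg_seq_mono[of m n "\<lambda>ps. seq_op ps ?f z" "\<lambda>_. 1"] seq_op_le_1[of n ?f _ z] f1 that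
    by (simp add: avg_seq_const[OF n])
  have le: "g y \<le> g x + V y + ennreal (?\<kappa> * sq_dist n x y)"
    if x: "x \<in> prob_simplex n" and y: "y \<in> prob_simplex n" for x y
  proof (cases "(\<Sum>k\<in>{1..n}. \<bar>x k - y k\<bar>) \<le> e")
    case True
    have "g y \<le> g x + V y"
      using close_points_coupling[OF f f1 e x y True, of m] by (simp add: g_def V_def V1_def \<delta>_def)
    then show ?thesis by (simp add: add_increasing2)
  next
    case False
    then have "e\<^sup>2 \<le> (\<Sum>k\<in>{1..n}. \<bar>x k - y k\<bar>)\<^sup>2" using e by (intro power_mono) auto
    then have "e\<^sup>2 \<le> real n * sq_dist n x y" using sum_abs_sq_le by (rule order_trans)
    then have "1 \<le> ?\<kappa> * sq_dist n x y" using e by (simp add: divide_simps)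
    then have "1 \<le> ennreal (?\<kappa> * sq_dist n x y)" by simp
    with g1[OF y] have "g y \<le> ennreal (?\<kappa> * sq_dist n x y)" by (rule order_trans)
    then show ?thesis by (simp add: add_increasing)
  qed
  have \<kappa>: "0 \<le> ?\<kappa>" by simp
  have "(gibbs_op n ^^ t) g y \<le> (gibbs_op n ^^ t) g x + ennreal (2 * ?\<rho> ^ t * ?\<kappa>) + (gibbs_op n ^^ t) V y"
    if y: "y \<in> prob_simplex n" for y
  proof -
    have "?\<rho> ^ t * ?\<kappa> * sq_dist n x y \<le> ?\<rho> ^ t * ?\<kappa> * 2"
      using sq_dist_le_2[OF x y] n by (intro mult_left_mono) auto
    then have "ennreal (?\<rho> ^ t * ?\<kappa> * sq_dist n x y) \<le> ennreal (2 * ?\<rho> ^ t * ?\<kappa>)"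
      by (intro ennreal_leI) (simp add: mult_ac)
    then have "(gibbs_op n ^^ t) g x + (gibbs_op n ^^ t) V y + ennreal (?\<rho> ^ t * ?\<kappa> * sq_dist n x y)
        \<le> (gibbs_op n ^^ t) g x + (gibbs_op n ^^ t) V y + ennreal (2 * ?\<rho> ^ t * ?\<kappa>)"
      by (rule add_left_mono)
    from order_trans[OF proportional_coupling[OF n \<kappa> g V le x y] this] show ?thesis
      by (simp only: ac_simps)
  qed
  then have "(\<integral>\<^sup>+ y. (gibbs_op n ^^ t) g y \<partial>?U)
      \<le> (\<integral>\<^sup>+ y. (gibbs_op n ^^ t) g x + ennreal (2 * ?\<rho> ^ t * ?\<kappa>) + (gibbs_op n ^^ t) V y \<partial>?U)"
    by (intro nn_integral_mono) simp
  also have "\<dots> = (gibbs_op n ^^ t) g x + ennreal (2 * ?\<rho> ^ t * ?\<kappa>) + (\<integral>\<^sup>+ y. (gibbs_op n ^^ t) V y \<partial>?U)"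
    using U.emeasure_space_1
    by (subst nn_integral_add) (simp_all only: cong measurable_gibbs_op_pow[OF V] nn_integral_const mult_1_right measurable_const borel_measurable_const)
  also have "(\<integral>\<^sup>+ y. (gibbs_op n ^^ t) V y \<partial>?U) = (\<integral>\<^sup>+ y. V y \<partial>?U)"
    by (rule nn_integral_simplex_uniform_gibbs_op_pow[OF n V])
  also have "(\<integral>\<^sup>+ y. V y \<partial>?U) = (\<integral>\<^sup>+ y. V1 y \<partial>?U) + \<delta>"
    using U.emeasure_space_1 unfolding V_def
    by (subst nn_integral_add) (simp_all only: cong V1 nn_integral_const mult_1_right measurable_const borel_measurable_const)
  also have "(\<integral>\<^sup>+ y. V1 y \<partial>?U) = avg_seq n m (\<lambda>ps. \<integral>\<^sup>+ y. split_cost e ps y \<partial>?U)"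
    unfolding V1_def by (rule avg_seq_nn_integral[symmetric]) (unfold cong, rule measurable_split_cost)
  also have "(gibbs_op n ^^ t) g x = emeasure (gibbs_kernel_pow n (t + m) x) A"
  proof -
    have "(gibbs_op n ^^ t) g x = (\<integral>\<^sup>+ z. ?f z \<partial>gibbs_kernel_pow n (t + m) x)"
      unfolding nn_integral_gibbs_kernel_pow[OF n f x] g_def by (simp add: funpow_add)
    also have "\<dots> = emeasure (gibbs_kernel_pow n (t + m) x) A"
      using measurable_space[OF gibbs_kernel_pow_measurable[OF n, of "t + m"], of x] x A
      by (intro nn_integral_indicator) (simp add: space_prob_algebra)
    finally show ?thesis .
  qed
  also have "(\<integral>\<^sup>+ y. (gibbs_op n ^^ t) g y \<partial>?U) = emeasure ?U A"
    unfolding nn_integral_simplex_uniform_gibbs_op_pow[OF n g] unfolding g_def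
      nn_integral_simplex_uniform_gibbs_op_pow[OF n f]
    using A by (intro nn_integral_indicator) (simp only: sets_simplex_uniform)
  finally have main: "emeasure ?U A \<le> emeasure (gibbs_kernel_pow n (t + m) x) A
      + ennreal (2 * ?\<rho> ^ t * ?\<kappa>) + (avg_seq n m (\<lambda>ps. \<integral>\<^sup>+ y. split_cost e ps y \<partial>?U) + \<delta>)" .
  have "avg_seq n m (\<lambda>ps. \<integral>\<^sup>+ y. split_cost e ps y \<partial>?U)
      \<le> avg_seq n m (\<lambda>_. of_nat m * (ennreal e * ennreal (real n - 1)))"
    using nn_integral_split_cost[OF n] by (intro avg_seq_mono) blast
  also have "\<dots> = ennreal (real m * (e * (real n - 1)))"
    using e n by (simp add: avg_seq_const[OF n] ennreal_mult ennreal_of_nat_eq_real_of_nat)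
  finally have "avg_seq n m (\<lambda>ps. \<integral>\<^sup>+ y. split_cost e ps y \<partial>?U) + \<delta>
      \<le> ennreal (real m * (e * (real n - 1))) + ennreal ((1 + exp (- real m / real n)) ^ n - 1)"
    unfolding \<delta>_def by (intro add_mono avg_seq_disconnected[OF n])
  from order_trans[OF main add_left_mono[OF this]] show ?thesis by (simp add: ac_simps)
qed

text \<open>
  About \<open>C n ln n\<close> steps are given to the second phase, which makes the random pairs connected
  up to probability \<open>2 n powr (1 - C)\<close>; at least \<open>9 C n ln n - 1\<close> steps remain for the first
  phase, and they bring the mean squared distance below a multiple of \<open>n powr (- 6 * C)\<close>. With
  \<open>e = n powr (- 2 * C)\<close> each of the three errors is at most a quarter of \<open>n powr (3 - C)\<close>.
\<close>

lemma coupling_error_bound: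
  fixes C :: real
  assumes C: "C > 3" and n: "real n > 4096" and t: "real t > 10 * C * real n * ln (real n)"
  obtains s m e where "t = s + m" "0 < e"
    "real m * (e * (real n - 1)) + ((1 + exp (- real m / real n)) ^ n - 1)
      + 2 * (1 - 2 / (3 * real n)) ^ s * (real n / e\<^sup>2) < real n powr (3 - C)"
proof -
  define L where "L = ln (real n)"
  define m where "m = nat \<lceil>C * real n * L\<rceil>"
  \<comment> \<open>With this exponent the splitting costs, linear in \<open>e\<close>, and the distance term, of order \<open>n powr (1 - 6 * C) / e\<^sup>2\<close>, decay with the same multiple of \<open>C\<close> in the exponent.\<close>
  define e where "e = real n powr (- (2 * C))"
  define P where "P = real n powr (3 - C)"
  have n0: "0 < real n" using n by simp
  have expL: "exp L = real n" using n0 by (simp add: L_def)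
  have powr: "real n powr a = exp (a * L)" for a using n0 by (simp add: powr_def L_def)
  have "8 \<le> ln (4096 :: real)"
  proof -
    have "ln (4096 :: real) = 12 * ln 2" using ln_realpow[of 2 12] by simp
    then show ?thesis using ln2_ge_two_thirds by simp
  qed
  also have "\<dots> \<le> L" unfolding L_def using n by simp
  finally have L: "8 \<le> L" .
  have Ln: "L \<le> real n" unfolding L_def using ln_le_minus_one[OF n0] by simp
  have CnL: "1 \<le> C * real n * L"
  proof -
    have "1 * 1 * 1 \<le> C * real n * L" using C n L by (intro mult_mono) auto
    then show ?thesis by simp
  qed
  have m_lower: "C * real n * L \<le> real m" unfolding m_def using CnL by linarith
  have m_upper: "real m \<le> C * real n * L + 1" unfolding m_def using CnL by linarith
  have t': "10 * (C * real n * L) < real t" using t by (simp add: L_def mult.assoc)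
  have mt: "m \<le> t" using m_upper t' CnL by linarith
  define s where "s = t - m"
  have ts: "t = s + m" using mt by (simp add: s_def)
  have s_lower: "9 * (C * real n * L) - 1 \<le> real s"
    using m_upper t' ts by simp
  have P0: "0 < P" using n0 by (simp add: P_def)
  \<comment> \<open>\<open>P\<close> is the target \<open>n powr (3 - C)\<close>.\<close>
  have T1: "real m * (e * (real n - 1)) \<le> P / 4"
  proof -
    have "8 * C \<le> exp (C * L)"
    proof -
      have "8 * C \<le> C * L" using L C by (simp add: mult.commute)
      also have "\<dots> \<le> exp (C * L)" using exp_ge_add_one_self[of "C * L"] by linarith
      finally show ?thesis .
    qed
    then have small: "2 * C * exp (- (C * L)) \<le> 1 / 4"
      by (simp add: exp_minus field_simps)
    have "real m \<le> 2 * C * real n * real n"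
    proof -
      have "C * real n * L \<le> C * real n * real n" using Ln C n0 by simp
      then show ?thesis using m_upper CnL by linarith
    qed
    then have "real m * (e * (real n - 1)) \<le> (2 * C * real n * real n) * (e * real n)"
      using n0 n C by (intro mult_mono) (auto simp: e_def)
    also have "\<dots> = P * (2 * C * exp (- (C * L)))"
    proof -
      have "real n * real n * real n * e = exp (3 * L - 2 * C * L)"
        unfolding e_def powr
        by (simp add: expL[symmetric] flip: exp_add)
      moreover have "P * exp (- (C * L)) = exp (3 * L - 2 * C * L)"
        unfolding P_def powr by (simp flip: exp_add; simp add: algebra_simps)
      ultimately show ?thesis by (simp add: mult_ac)
    qed
    also have "\<dots> \<le> P * (1 / 4)" using small P0 by (intro mult_left_mono) auto
    finally show ?thesis by simp
  qed
  have T2: "(1 + exp (- real m / real n)) ^ n - 1 \<le> P / 4"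
  proof -
    define z where "z = exp (L - C * L)"
    have "- real m / real n \<le> - (C * L)" using m_lower n0 by (simp add: field_simps)
    then have q: "exp (- real m / real n) \<le> exp (- (C * L))" by simp
    have "1 + exp (- real m / real n) \<le> exp (exp (- (C * L)))"
      using q exp_ge_add_one_self[of "exp (- (C * L))"] by linarith
    then have "(1 + exp (- real m / real n)) ^ n \<le> exp (exp (- (C * L))) ^ n"
      by (rule power_mono) (simp add: add_nonneg_nonneg)
    also have "\<dots> = exp z"
    proof -
      have "real n * exp (- (C * L)) = z"
        unfolding z_def by (simp add: expL[symmetric] flip: exp_add)
      then show ?thesis by (simp flip: exp_of_nat_mult)
    qed
    finally have le: "(1 + exp (- real m / real n)) ^ n \<le> exp z" .
    have "L \<le> C * L" using C L by simp
    then have z1: "z \<le> 1" by (simp add: z_def)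
    have z0: "0 \<le> z" by (simp add: z_def)
    have "z\<^sup>2 \<le> z" using z0 z1 by (simp add: power2_eq_square mult_left_le)
    then have "exp z - 1 \<le> 2 * z" using exp_bound[OF z0 z1] by linarith
    also have "2 * z \<le> P / 4"
    proof -
      have "P = z * (real n * real n)"
        unfolding P_def powr z_def by (simp add: expL[symmetric] flip: exp_add; simp add: algebra_simps)
      moreover have "8 \<le> real n * real n"
        using mult_mono[of 8 "real n" 1 "real n"] n by simp
      ultimately show ?thesis using mult_left_mono[of 8 "real n * real n" z] z0 by simp
    qed
    finally show ?thesis using le by linarith
  qed
  have T3: "2 * (1 - 2 / (3 * real n)) ^ s * (real n / e\<^sup>2) \<le> P / 4"
  proof -
    have "1 - 2 / (3 * real n) \<le> exp (- (2 / (3 * real n)))"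
      using exp_ge_add_one_self[of "- (2 / (3 * real n))"] by simp
    then have "(1 - 2 / (3 * real n)) ^ s \<le> exp (- (2 / (3 * real n))) ^ s"
      using n by (intro power_mono) (auto simp: field_simps)
    also have "\<dots> = exp (- (2 / (3 * real n)) * real s)"
      by (simp flip: exp_of_nat_mult add: mult.commute)
    also have "\<dots> \<le> exp (1 - 6 * C * L)"
    proof -
      have "- (2 / (3 * real n)) * real s \<le> - (2 / (3 * real n)) * (9 * (C * real n * L) - 1)"
        using s_lower n0 by (intro mult_left_mono_neg) auto
      also have "\<dots> = 2 / (3 * real n) - 6 * C * L" using n0 by (simp add: field_simps)
      also have "\<dots> \<le> 1 - 6 * C * L" using n by simp
      finally show ?thesis by simp
    qed
    also have "\<dots> \<le> 3 * exp (- (6 * C * L))"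
      using exp_le by (simp add: exp_diff exp_minus field_simps)
    finally have "(1 - 2 / (3 * real n)) ^ s \<le> 3 * exp (- (6 * C * L))" .
    then have "2 * (1 - 2 / (3 * real n)) ^ s * (real n / e\<^sup>2) \<le> 2 * (3 * exp (- (6 * C * L))) * (real n / e\<^sup>2)"
      by (intro mult_right_mono mult_left_mono) auto
    also have "\<dots> = 6 * exp (L - 2 * C * L)"
    proof -
      have "real n / e\<^sup>2 = exp (L + 4 * C * L)"
        unfolding e_def powr
        by (simp add: expL[symmetric] power2_eq_square flip: exp_add exp_diff)
      then show ?thesis by (simp flip: exp_add; simp add: algebra_simps)
    qed
    also have "\<dots> \<le> P / 4"
    proof -
      have "24 \<le> real n" using n by simp
      then have "24 \<le> exp (L + (L + C * L))"
      proof -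
        have "exp L \<le> exp (L + (L + C * L))" using L C by simp
        then show ?thesis using expL n by simp
      qed
      then have "24 * exp (L - 2 * C * L) \<le> exp (L + (L + C * L)) * exp (L - 2 * C * L)"
        by (intro mult_right_mono) auto
      also have "\<dots> = P" unfolding P_def powr by (simp flip: exp_add; simp add: algebra_simps)
      finally show ?thesis by simp
    qed
    finally show ?thesis .
  qed
  have "e > 0" using n0 by (simp add: e_def)
  from that[OF ts this] T1 T2 T3 P0 show ?thesis unfolding P_def by linarith
qed

lemma prob_space_gibbs_kernel_pow:
  assumes "n \<ge> 2" "x \<in> prob_simplex n"
  shows "prob_space (gibbs_kernel_pow n t x)" "sets (gibbs_kernel_pow n t x) = sets (simplex_space n)"
    "space (gibbs_kernel_pow n t x) = prob_simplex n"
proof -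
  have *: "gibbs_kernel_pow n t x \<in> space (prob_algebra (simplex_space n))"
    using measurable_space[OF gibbs_kernel_pow_measurable[OF assms(1), of t], of x] assms(2) by simp
  then show "prob_space (gibbs_kernel_pow n t x)"
    and s: "sets (gibbs_kernel_pow n t x) = sets (simplex_space n)"
    by (simp_all add: space_prob_algebra)
  show "space (gibbs_kernel_pow n t x) = prob_simplex n"
    using sets_eq_imp_space_eq[OF s] by simp
qed

text \<open>
  The comparison bounds the uniform distribution from above by the chain; applied to the
  complement it gives the other direction.
\<close>

lemma gibbs_sampler_upper_bound:
  fixes C :: real
  assumes C: "C > 3" and n: "real n > 4096" and t: "real t > 10 * C * real n * ln (real n)"
    and x: "x \<in> prob_simplex n" and A: "A \<in> sets (simplex_space n)"
  shows "\<bar>measure (gibbs_kernel_pow n t x) A - measure (simplex_uniform n) A\<bar> < real n powr (3 - C)"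
proof -
  have n2: "n \<ge> 2" using n by linarith
  interpret U: prob_space "simplex_uniform n" using n2 by (intro prob_space_simplex_uniform) simp
  interpret K: prob_space "gibbs_kernel_pow n t x" by (rule prob_space_gibbs_kernel_pow[OF n2 x])
  note K = prob_space_gibbs_kernel_pow(2,3)[OF n2 x, of t]
  obtain s m e where ts: "t = s + m" and e: "0 < e" and
    err: "real m * (e * (real n - 1)) + ((1 + exp (- real m / real n)) ^ n - 1)
      + 2 * (1 - 2 / (3 * real n)) ^ s * (real n / e\<^sup>2) < real n powr (3 - C)" (is "?a + ?b + ?c < _")
    using coupling_error_bound[OF C n t] by metis
  have nonneg: "0 \<le> ?a" "0 \<le> ?b" "0 \<le> ?c" using e n by auto
  have le: "U.prob B \<le> K.prob B + (?a + ?b + ?c)" if B: "B \<in> sets (simplex_space n)" for B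
  proof -
    have "ennreal (U.prob B) \<le> ennreal (K.prob B) + (ennreal ?a + ennreal ?b + ennreal ?c)"
      using emeasure_uniform_le_kernel[OF n2 x B e, of s m]
      unfolding ts[symmetric] U.emeasure_eq_measure K.emeasure_eq_measure .
    also have "\<dots> = ennreal (K.prob B + (?a + ?b + ?c))"
      using nonneg by (simp only: ennreal_plus measure_nonneg add_nonneg_nonneg)
    finally show ?thesis using nonneg by (subst (asm) ennreal_le_iff) auto
  qed
  have cA: "prob_simplex n - A \<in> sets (simplex_space n)"
    using sets.compl_sets[OF A] by simp
  have "U.prob (prob_simplex n - A) = 1 - U.prob A" "K.prob (prob_simplex n - A) = 1 - K.prob A"
    using U.prob_compl[of A] K.prob_compl[of A] A K by simp_all
  then show ?thesis using le[OF A] le[OF cA] err by linarith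
qed

section \<open>Spread of the support and the lower bound\<close>

definition support_size :: "nat \<Rightarrow> (nat \<Rightarrow> real) \<Rightarrow> nat" where
  "support_size n x = card {k \<in> {1..n}. x k \<noteq> 0}"

text \<open>
  For a support of size \<open>k\<close> the value is \<open>k / (n + 1 - k)\<close>. This function is fitted to the
  spread of the support: \<open>k\<close> grows by one with probability at most
  \<open>2 k (n - k) / (n (n - 1))\<close>, and the increment \<open>(n + 1) / ((n - k) (n + 1 - k))\<close> makes the
  resulting bound for the mean growth factor the same for all \<open>k < n\<close>.
\<close>

definition support_odds :: "nat \<Rightarrow> (nat \<Rightarrow> real) \<Rightarrow> ennreal" where
  "support_odds n x = ennreal (real (support_size n x) / (real n + 1 - real (support_size n x)))"

lemma support_size_le: "support_size n x \<le> n"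
proof -
  have "card {k \<in> {1..n}. x k \<noteq> 0} \<le> card {1..n}" by (rule card_mono) auto
  then show ?thesis by (simp add: support_size_def)
qed

lemma measurable_support_odds: "support_odds n \<in> borel_measurable (simplex_space n)"
proof -
  have ind: "(\<lambda>x. indicator {0::real} (x k) :: real) \<in> borel_measurable (simplex_space n)" if "k \<in> {1..n}" for k
    by (rule measurable_compose[OF measurable_simplex_coord[OF that]]) simp
  have eq: "real (support_size n x) = (\<Sum>k\<in>{1..n}. 1 - indicator {0} (x k))" for x
  proof -
    have "(\<Sum>k\<in>{1..n}. 1 - indicator {0} (x k) :: real) = (\<Sum>k\<in>{1..n}. if x k \<noteq> 0 then 1 else 0)"
      by (rule sum.cong) auto
    then show ?thesis by (simp add: support_size_def sum.If_cases Int_def)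
  qed
  have "(\<lambda>x. real (support_size n x)) \<in> borel_measurable (simplex_space n)"
    unfolding eq by (intro borel_measurable_sum borel_measurable_diff ind) auto
  then show ?thesis
    unfolding support_odds_def[abs_def]
    by (intro measurable_compose[OF _ measurable_ennreal] borel_measurable_divide borel_measurable_diff) auto
qed

lemma support_size_update:
  fixes x :: "nat \<Rightarrow> real"
  assumes p: "p \<in> index_pairs n"
  defines "S \<equiv> {k \<in> {1..n}. x k \<noteq> 0}"
  shows "support_size n (upd p l x) \<le> support_size n x + of_bool (p \<in> crossing_pairs n S)"
proof -
  obtain i j where ij: "p = (i, j)" "i \<in> {1..n}" "j \<in> {1..n}" "i \<noteq> j"
    using p by (auto simp: index_pairs_def)
  let ?S' = "{k \<in> {1..n}. upd p l x k \<noteq> 0}"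
  have fin: "finite S" by (simp add: S_def)
  have sub: "?S' \<subseteq> S \<union> {i, j}" by (auto simp: S_def ij gibbs_update_def)
  have "?S' \<subseteq> S \<or> (p \<in> crossing_pairs n S \<and> (\<exists>k. ?S' \<subseteq> insert k S))"
  proof (cases "i \<in> S")
    case True
    then show ?thesis using sub p ij(1) by (cases "j \<in> S") (auto simp: crossing_pairs_def)
  next
    case iS: False
    show ?thesis
    proof (cases "j \<in> S")
      case True
      then show ?thesis using sub iS p ij(1) by (auto simp: crossing_pairs_def)
    next
      case False
      then have "x i = 0" "x j = 0" using iS ij by (auto simp: S_def)
      then have "?S' \<subseteq> S" by (auto simp: S_def ij gibbs_update_def)
      then show ?thesis ..
    qed
  qed
  then show ?thesis
  proof
    assume "?S' \<subseteq> S"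
    from card_mono[OF fin this] show ?thesis by (simp add: support_size_def S_def)
  next
    assume *: "p \<in> crossing_pairs n S \<and> (\<exists>k. ?S' \<subseteq> insert k S)"
    then obtain k where "?S' \<subseteq> insert k S" by blast
    then have "card ?S' \<le> card (insert k S)" using fin by (intro card_mono) auto
    also have "\<dots> \<le> card S + 1" using fin by (simp add: card_insert_if)
    finally show ?thesis using * by (simp add: support_size_def S_def)
  qed
qed

lemma gibbs_op_support_odds:
  assumes n: "n \<ge> 2"
  shows "gibbs_op n (support_odds n) x
    \<le> ennreal (1 + 2 * (real n + 1) / (real n * (real n - 1))) * support_odds n x"
proof -
  define S where "S = {k \<in> {1..n}. x k \<noteq> 0}"
  define I where "I = real (support_size n x)"
  define d where "d = (real n + 1) / ((real n - I) * (real n + 1 - I))"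
  let ?h = "\<lambda>a. a / (real n + 1 - a)" and ?N = "real (card (index_pairs n))"
  have I: "0 \<le> I" "I \<le> real n" using support_size_le[of n x] by (auto simp: I_def)
  have S: "S \<subseteq> {1..n}" "real (card S) = I" by (auto simp: S_def I_def support_size_def)
  have N: "0 < ?N"
    using index_pairs_nonempty[OF n] finite_index_pairs[of n] by (simp add: card_gt_0_iff)
  have d0: "0 \<le> d" using I by (simp add: d_def)
  have h0: "0 \<le> ?h I" using I by simp
  have h_mono: "?h a \<le> ?h b" if "0 \<le> a" "a \<le> b" "b \<le> real n" for a b
    using that by (intro frac_le) auto
  have resample: "resample p (support_odds n) x \<le> ennreal (?h I + of_bool (p \<in> crossing_pairs n S) * d)"
    if p: "p \<in> index_pairs n" for p
  proof -
    have "support_odds n (upd p l x) \<le> ennreal (?h I + of_bool (p \<in> crossing_pairs n S) * d)" for l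
    proof -
      define J where "J = real (support_size n (upd p l x))"
      have J: "0 \<le> J" "J \<le> real n" using support_size_le[of n "upd p l x"] by (auto simp: J_def)
      have JI: "J \<le> I + of_bool (p \<in> crossing_pairs n S)"
        using support_size_update[OF p, of l x] unfolding J_def I_def S_def[symmetric]
        by (cases "p \<in> crossing_pairs n S") auto
      have "?h J \<le> ?h I + of_bool (p \<in> crossing_pairs n S) * d"
      proof (cases "p \<in> crossing_pairs n S")
        case False
        then show ?thesis using h_mono[OF J(1) _ I(2)] JI by simp
      next
        case True
        have I1: "I \<le> real n - 1"
        proof -
          have "S \<noteq> {1..n}" using True p by (auto simp: crossing_pairs_def index_pairs_def)
          then have "card S < n" using psubset_card_mono[of "{1..n}" S] S(1) by auto
          then show ?thesis using S(2) by linarith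
        qed
        have "?h J \<le> ?h (I + 1)" by (rule h_mono[OF J(1)]) (use JI True I1 in auto)
        also have "\<dots> = ?h I + d"
        proof -
          define a where "a = real n - I"
          have "1 \<le> a" using I1 by (simp add: a_def)
          then have "(I + 1) / a = I / (a + 1) + (a + I + 1) / (a * (a + 1))"
            by (simp add: divide_simps; simp add: algebra_simps)
          moreover have "real n + 1 - (I + 1) = a" "real n + 1 - I = a + 1" "real n + 1 = a + I + 1"
            by (simp_all add: a_def)
          ultimately show ?thesis unfolding d_def a_def[symmetric] by simp
        qed
        finally show ?thesis using True by simp
      qed
      then show ?thesis unfolding support_odds_def J_def by (rule ennreal_leI)
    qed
    then have "resample p (support_odds n) x
        \<le> (\<integral>\<^sup>+ l. ennreal (?h I + of_bool (p \<in> crossing_pairs n S) * d) \<partial>unit_law)"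
      unfolding resample_def by (intro nn_integral_mono)
    also have "\<dots> = ennreal (?h I + of_bool (p \<in> crossing_pairs n S) * d)"
      using resample_const[of p _ x] unfolding resample_def .
    finally show ?thesis .
  qed
  have "gibbs_op n (support_odds n) x
      \<le> (\<Sum>p\<in>index_pairs n. ennreal ((?h I + of_bool (p \<in> crossing_pairs n S) * d) / ?N))"
    unfolding gibbs_op_def nn_integral_pair_law
  proof (rule sum_mono)
    fix p assume p: "p \<in> index_pairs n"
    have nonneg: "0 \<le> ?h I + of_bool (p \<in> crossing_pairs n S) * d" using h0 d0 by simp
    have "resample p (support_odds n) x * ennreal (1 / ?N)
        \<le> ennreal (?h I + of_bool (p \<in> crossing_pairs n S) * d) * ennreal (1 / ?N)"
      by (rule mult_right_mono[OF resample[OF p]]) simp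
    also have "\<dots> = ennreal ((?h I + of_bool (p \<in> crossing_pairs n S) * d) / ?N)"
      using nonneg by (simp only: ennreal_mult'[symmetric] times_divide_eq_right mult_1_right)
    finally show "resample p (support_odds n) x * ennreal (1 / ?N)
        \<le> ennreal ((?h I + of_bool (p \<in> crossing_pairs n S) * d) / ?N)" .
  qed
  also have "\<dots> = ennreal (\<Sum>p\<in>index_pairs n. (?h I + of_bool (p \<in> crossing_pairs n S) * d) / ?N)"
    using h0 d0 by (intro sum_ennreal) simp
  also have "(\<Sum>p\<in>index_pairs n. (?h I + of_bool (p \<in> crossing_pairs n S) * d) / ?N)
      = ?h I + real (card (crossing_pairs n S)) * d / ?N"
  proof -
    have "(\<Sum>p\<in>index_pairs n. of_bool (p \<in> crossing_pairs n S) :: real) = real (card (crossing_pairs n S))"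
    proof -
      have "index_pairs n \<inter> crossing_pairs n S = crossing_pairs n S" by (auto simp: crossing_pairs_def)
      then show ?thesis by (simp add: of_bool_def sum.If_cases finite_index_pairs)
    qed
    then show ?thesis using N
      by (simp add: sum.distrib add_divide_distrib flip: sum_divide_distrib sum_distrib_right)
  qed
  also have "ennreal \<dots> \<le> ennreal ((1 + 2 * (real n + 1) / (real n * (real n - 1))) * ?h I)"
  proof (rule ennreal_leI, cases "I = real n")
    case True
    then have "card S = n" using S(2) by simp
    then have "S = {1..n}" using card_subset_eq[of "{1..n}" S] S(1) by simp
    then have "crossing_pairs n S = {}" by (auto simp: crossing_pairs_def index_pairs_def)
    moreover have "1 * ?h I \<le> (1 + 2 * (real n + 1) / (real n * (real n - 1))) * ?h I"
      using h0 n by (intro mult_right_mono) auto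
    ultimately show "?h I + real (card (crossing_pairs n S)) * d / ?N
        \<le> (1 + 2 * (real n + 1) / (real n * (real n - 1))) * ?h I" by simp
  next
    case False
    then have "real n - I \<noteq> 0" by simp
    moreover have "I * a * (c / (a * b)) = c * (I / b)" if "a \<noteq> 0" for a b c
      using that by simp
    ultimately have crossing: "real (card (crossing_pairs n S)) * d = (real n + 1) * ?h I"
      unfolding card_crossing_pairs[OF S(1)] S(2) d_def by blast
    have rearrange: "h + c * h / (D / 2) = (1 + 2 * c / D) * h" if "D \<noteq> 0" for h c D :: real
      using that by (simp add: field_simps)
    have "?h I + real (card (crossing_pairs n S)) * d / ?N
        = (1 + 2 * (real n + 1) / (real n * (real n - 1))) * ?h I"
      unfolding card_index_pairs crossing by (rule rearrange) (use n in simp)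
    then show "?h I + real (card (crossing_pairs n S)) * d / ?N
        \<le> (1 + 2 * (real n + 1) / (real n * (real n - 1))) * ?h I" by simp
  qed
  also have "\<dots> = ennreal (1 + 2 * (real n + 1) / (real n * (real n - 1))) * support_odds n x"
    using h0 n unfolding support_odds_def I_def[symmetric] by (subst ennreal_mult) auto
  finally show ?thesis .
qed

lemma gibbs_op_cmult:
  assumes f: "f \<in> borel_measurable (simplex_space n)" and x: "x \<in> prob_simplex n"
  shows "gibbs_op n (\<lambda>z. c * f z) x = c * gibbs_op n f x"
proof -
  have "gibbs_op n (\<lambda>z. c * f z) x = (\<integral>\<^sup>+ p. c * resample p f x \<partial>pair_law n)"
    unfolding gibbs_op_def
  proof (rule nn_integral_cong)
    fix p assume "p \<in> space (pair_law n)"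
    then have p: "p \<in> index_pairs n" by simp
    show "resample p (\<lambda>z. c * f z) x = c * resample p f x"
      unfolding resample_def by (rule nn_integral_cmult[OF measurable_comp_upd[OF f p x]])
  qed
  also have "\<dots> = c * gibbs_op n f x"
    unfolding gibbs_op_def by (rule nn_integral_cmult[OF measurable_pair_law])
  finally show ?thesis .
qed

lemma gibbs_op_pow_support_odds:
  assumes n: "n \<ge> 2" and x: "x \<in> prob_simplex n"
  defines "\<alpha> \<equiv> 2 * (real n + 1) / (real n * (real n - 1))"
  shows "(gibbs_op n ^^ t) (support_odds n) x \<le> ennreal ((1 + \<alpha>) ^ t) * support_odds n x"
  using x
proof (induction t arbitrary: x)
  case (Suc t)
  have \<alpha>: "0 \<le> \<alpha>" using n by (simp add: \<alpha>_def)
  have "(gibbs_op n ^^ Suc t) (support_odds n) x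
      \<le> gibbs_op n (\<lambda>z. ennreal ((1 + \<alpha>) ^ t) * support_odds n z) x"
    unfolding funpow.simps o_apply by (rule gibbs_op_mono[OF Suc.IH Suc.prems])
  also have "\<dots> = ennreal ((1 + \<alpha>) ^ t) * gibbs_op n (support_odds n) x"
    by (rule gibbs_op_cmult[OF measurable_support_odds Suc.prems])
  also have "\<dots> \<le> ennreal ((1 + \<alpha>) ^ t) * (ennreal (1 + \<alpha>) * support_odds n x)"
    using gibbs_op_support_odds[OF n, of x] by (intro mult_left_mono) (auto simp: \<alpha>_def)
  also have "\<dots> = ennreal ((1 + \<alpha>) ^ Suc t) * support_odds n x"
  proof -
    have "ennreal ((1 + \<alpha>) ^ t) * ennreal (1 + \<alpha>) = ennreal ((1 + \<alpha>) ^ Suc t)"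
      using \<alpha> by (subst ennreal_mult[symmetric]) (auto simp: mult.commute)
    then show ?thesis by (simp only: mult.assoc[symmetric])
  qed
  finally show ?case .
qed simp

definition vertex :: "nat \<Rightarrow> nat \<Rightarrow> real" where
  "vertex n = (\<lambda>k\<in>{1..n}. if k = 1 then 1 else 0)"

lemma vertex_in_simplex: "n \<ge> 1 \<Longrightarrow> vertex n \<in> prob_simplex n"
  by (auto simp: vertex_def prob_simplex_def)

lemma support_odds_vertex:
  assumes "n \<ge> 1"
  shows "support_odds n (vertex n) = ennreal (1 / real n)"
proof -
  have "{k \<in> {1..n}. vertex n k \<noteq> 0} = {1}" using assms by (auto simp: vertex_def)
  then show ?thesis by (simp add: support_odds_def support_size_def)
qed

text \<open>
  At the vertex \<open>support_odds\<close> is \<open>1 / n\<close>, on points without zero coordinates it is \<open>n\<close>. So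
  Markov's inequality bounds the probability that the chain has left the boundary by \<open>1 / n\<^sup>2\<close>
  times the growth factor, while the boundary is a null set for the uniform distribution.
\<close>

lemma kernel_boundary_ge:
  assumes n: "n \<ge> 2"
  defines "A \<equiv> {x \<in> prob_simplex n. \<exists>k\<in>{1..n}. x k = 0}"
  shows "A \<in> sets (simplex_space n)" "measure (simplex_uniform n) A = 0"
    "measure (gibbs_kernel_pow n t (vertex n)) A
      \<ge> 1 - (1 + 2 * (real n + 1) / (real n * (real n - 1))) ^ t / (real n)\<^sup>2"
proof -
  let ?Z = "\<lambda>k. {x \<in> prob_simplex n. x k = 0}" and ?K = "gibbs_kernel_pow n t (vertex n)"
  let ?c = "(1 + 2 * (real n + 1) / (real n * (real n - 1))) ^ t"
  have v: "vertex n \<in> prob_simplex n" using n by (intro vertex_in_simplex) simp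
  have Z: "?Z k \<in> sets (simplex_space n)" if "k \<in> {1..n}" for k
  proof -
    have "?Z k = (\<lambda>x. x k) -` {0} \<inter> space (simplex_space n)" by auto
    also have "\<dots> \<in> sets (simplex_space n)"
      by (rule measurable_sets[OF measurable_simplex_coord[OF that]]) simp
    finally show ?thesis .
  qed
  have A_eq: "A = (\<Union>k\<in>{1..n}. ?Z k)" by (auto simp: A_def)
  show A: "A \<in> sets (simplex_space n)" unfolding A_eq by (intro sets.finite_UN Z) auto
  have "A \<in> null_sets (simplex_uniform n)"
    unfolding A_eq
    by (intro null_sets_UN' countable_finite null_setsI simplex_uniform_coord_eq_0[OF n])
       (simp_all only: sets_simplex_uniform Z finite_atLeastAtMost)
  then show "measure (simplex_uniform n) A = 0" by (simp add: null_sets_def measure_def)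
  interpret K: prob_space ?K by (rule prob_space_gibbs_kernel_pow[OF n v])
  note Ks = prob_space_gibbs_kernel_pow(2,3)[OF n v, of t]
  define B where "B = prob_simplex n - A"
  have B: "B \<in> sets (simplex_space n)" unfolding B_def using sets.compl_sets[OF A] by simp
  have B_le: "ennreal (real n) * indicator B z \<le> support_odds n z" for z
  proof (cases "z \<in> B")
    case True
    then have "{k \<in> {1..n}. z k \<noteq> 0} = {1..n}" by (auto simp: B_def A_def)
    then show ?thesis using True by (simp add: support_odds_def support_size_def)
  qed simp
  have "ennreal (real n) * emeasure ?K B = (\<integral>\<^sup>+ z. ennreal (real n) * indicator B z \<partial>?K)"
    using B Ks(1) by (intro nn_integral_cmult_indicator[symmetric]) simp
  also have "\<dots> \<le> (\<integral>\<^sup>+ z. support_odds n z \<partial>?K)" by (rule nn_integral_mono[OF B_le])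
  also have "\<dots> = (gibbs_op n ^^ t) (support_odds n) (vertex n)"
    by (rule nn_integral_gibbs_kernel_pow[OF n measurable_support_odds v])
  also have "\<dots> \<le> ennreal ?c * ennreal (1 / real n)"
    using gibbs_op_pow_support_odds[OF n v, of t] support_odds_vertex[of n] n by simp
  finally have "ennreal (real n * K.prob B) \<le> ennreal (?c * (1 / real n))"
    unfolding K.emeasure_eq_measure using n by (simp only: ennreal_mult'[symmetric] of_nat_0_le_iff
        ennreal_mult''[symmetric] zero_le_divide_1_iff)
  then have "real n * K.prob B \<le> ?c * (1 / real n)"
    using n by (subst (asm) ennreal_le_iff) auto
  then have "K.prob B \<le> ?c / (real n)\<^sup>2" using n by (simp add: field_simps power2_eq_square)
  moreover have "K.prob B = 1 - K.prob A"
    unfolding B_def using K.prob_compl[of A] A Ks by simp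
  ultimately show "measure ?K A \<ge> 1 - ?c / (real n)\<^sup>2" by simp
qed

text \<open>
  Below \<open>(1 - C) n ln n\<close> steps the growth factor is at most \<open>n powr (2 * (1 + C) * (1 - C))\<close>,
  once \<open>n\<close> is so large that \<open>(n + 1) / (n - 1) \<le> 1 + C\<close>.
\<close>

lemma gibbs_sampler_lower_bound:
  fixes C :: real
  assumes C: "0 < C" "C < 1" and n: "n \<ge> 2" "2 \<le> C * (real n - 1)"
    and t: "real t < (1 - C) * real n * ln (real n)"
  shows "\<exists>x\<in>prob_simplex n. \<exists>A\<in>sets (simplex_space n).
    1 - real n powr (- 2 * C\<^sup>2)
      \<le> \<bar>measure (gibbs_kernel_pow n t x) A - measure (simplex_uniform n) A\<bar>"
proof -
  define A where "A = {x \<in> prob_simplex n. \<exists>k\<in>{1..n}. x k = 0}"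
  let ?\<alpha> = "2 * (real n + 1) / (real n * (real n - 1))"
  have n1: "1 < real n" using n by simp
  have L: "0 \<le> ln (real n)" using n1 by simp
  have "(1 + ?\<alpha>) ^ t \<le> exp ?\<alpha> ^ t"
    using exp_ge_add_one_self[of ?\<alpha>] n1 by (intro power_mono) auto
  also have "\<dots> = exp (?\<alpha> * real t)" by (simp flip: exp_of_nat_mult add: mult.commute)
  also have "\<dots> \<le> exp (2 * (1 + C) * (1 - C) * ln (real n))"
  proof -
    have "?\<alpha> * real t \<le> ?\<alpha> * ((1 - C) * real n * ln (real n))"
      using t n1 by (intro mult_left_mono) auto
    also have "\<dots> = 2 * ((real n + 1) / (real n - 1)) * ((1 - C) * ln (real n))"
      using n1 by (simp add: field_simps)
    also have "\<dots> \<le> 2 * (1 + C) * ((1 - C) * ln (real n))"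
    proof -
      have "(real n + 1) / (real n - 1) \<le> 1 + C" using n n1 by (simp add: divide_le_eq algebra_simps)
      then show ?thesis using C L by (intro mult_right_mono mult_left_mono) auto
    qed
    finally show ?thesis by (simp add: mult.assoc)
  qed
  finally have "(1 + ?\<alpha>) ^ t / (real n)\<^sup>2 \<le> exp (2 * (1 + C) * (1 - C) * ln (real n)) / (real n)\<^sup>2"
    by (rule divide_right_mono) simp
  also have "\<dots> = real n powr (- 2 * C\<^sup>2)"
  proof -
    have "(real n)\<^sup>2 = exp (2 * ln (real n))" using n1 by (simp add: exp_double)
    then show ?thesis using n1
      by (simp add: powr_def power2_eq_square flip: exp_diff; simp add: algebra_simps)
  qed
  finally have "1 - real n powr (- 2 * C\<^sup>2) \<le> measure (gibbs_kernel_pow n t (vertex n)) A"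
    using kernel_boundary_ge(3)[OF n(1), of t] unfolding A_def by linarith
  also have "\<dots> = \<bar>measure (gibbs_kernel_pow n t (vertex n)) A - measure (simplex_uniform n) A\<bar>"
    using kernel_boundary_ge(2)[OF n(1)] unfolding A_def by (simp only: diff_0_right abs_of_nonneg measure_nonneg)
  finally have "1 - real n powr (- 2 * C\<^sup>2)
      \<le> \<bar>measure (gibbs_kernel_pow n t (vertex n)) A - measure (simplex_uniform n) A\<bar>" .
  moreover have "A \<in> sets (simplex_space n)"
    unfolding A_def by (rule kernel_boundary_ge(1)[OF n(1)])
  moreover have "vertex n \<in> prob_simplex n" using n(1) by (intro vertex_in_simplex) simp
  ultimately show ?thesis by blast
qed

section \<open>The mixing time of the Gibbs sampler\<close>

theorem theorem1p1:
  shows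
    "(\<forall>(C::real) (n::nat).
        C > 3 \<and> real n > max 4096 (2 * C + 7 / 2) \<and>
        real n / ln (real n) > 3 * (1 / 2 + C) * C / (C / 2 - 1 / 4) \<longrightarrow>
        (\<forall>t::nat. real t > 10 * C * real n * ln (real n) \<longrightarrow>
          (\<forall>x\<in>prob_simplex n. \<forall>A\<in>sets (simplex_space n).
            \<bar>measure (gibbs_kernel_pow n t x) A - measure (simplex_uniform n) A\<bar>
              < real n powr (3 - C) + 2 * real n powr (- (C / 2) + 1 / 4)
                + 4 * real n powr (11 / 4 - C))))
     \<and>
     (\<forall>(C::real) (t::nat \<Rightarrow> nat).
        0 < C \<and> C < 1 \<and> (\<forall>n\<ge>2. real (t n) < (1 - C) * real n * ln (real n)) \<longrightarrow>
        liminf (\<lambda>n. SUP x\<in>prob_simplex n. SUP A\<in>sets (simplex_space n).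
          ereal \<bar>measure (gibbs_kernel_pow n (t n) x) A - measure (simplex_uniform n) A\<bar>) = 1)"
proof (intro conjI allI impI ballI)
  fix C :: real and n t :: nat and x A
  assume h: "C > 3 \<and> real n > max 4096 (2 * C + 7 / 2) \<and>
      real n / ln (real n) > 3 * (1 / 2 + C) * C / (C / 2 - 1 / 4)"
    and t: "real t > 10 * C * real n * ln (real n)"
    and x: "x \<in> prob_simplex n" and A: "A \<in> sets (simplex_space n)"
  have "\<bar>measure (gibbs_kernel_pow n t x) A - measure (simplex_uniform n) A\<bar> < real n powr (3 - C)"
    using h by (intro gibbs_sampler_upper_bound[OF _ _ t x A]) auto
  moreover have "0 \<le> real n powr (- (C / 2) + 1 / 4)" "0 \<le> real n powr (11 / 4 - C)" by simp_all
  ultimately show "\<bar>measure (gibbs_kernel_pow n t x) A - measure (simplex_uniform n) A\<bar>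
      < real n powr (3 - C) + 2 * real n powr (- (C / 2) + 1 / 4) + 4 * real n powr (11 / 4 - C)"
    by linarith
next
  fix C :: real and t :: "nat \<Rightarrow> nat"
  assume h: "0 < C \<and> C < 1 \<and> (\<forall>n\<ge>2. real (t n) < (1 - C) * real n * ln (real n))"
  let ?D = "\<lambda>n x A. \<bar>measure (gibbs_kernel_pow n (t n) x) A - measure (simplex_uniform n) A\<bar>"
  let ?S = "\<lambda>n. SUP x\<in>prob_simplex n. SUP A\<in>sets (simplex_space n). ereal (?D n x A)"
  have C: "0 < C" "C < 1" using h by auto
  have lower: "\<forall>\<^sub>F n in sequentially. ereal (1 - real n powr (- 2 * C\<^sup>2)) \<le> ?S n"
  proof -
    have "\<forall>\<^sub>F n in sequentially. 2 / C + 1 \<le> real n"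
      using filterlim_real_sequentially by (simp add: filterlim_at_top)
    then show ?thesis
      using eventually_ge_at_top[of 2]
    proof eventually_elim
      case (elim n)
      have "2 \<le> C * (real n - 1)" using elim(1) C by (simp add: field_simps)
      from gibbs_sampler_lower_bound[OF C elim(2) this, of "t n"] h elim(2)
      obtain x A where "x \<in> prob_simplex n" "A \<in> sets (simplex_space n)"
        and le: "1 - real n powr (- 2 * C\<^sup>2) \<le> ?D n x A" by blast
      then have "ereal (?D n x A) \<le> ?S n"
        by (intro SUP_upper2[of x] SUP_upper2[of A]) auto
      with le show ?case by (meson ereal_less_eq(3) order_trans)
    qed
  qed
  have upper: "\<forall>\<^sub>F n in sequentially. ?S n \<le> 1"
    using eventually_ge_at_top[of 2]
  proof eventually_elim
    case (elim n)
    interpret U: prob_space "simplex_uniform n" using elim by (intro prob_space_simplex_uniform) simp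
    show ?case
    proof (intro SUP_least)
      fix x A assume x: "x \<in> prob_simplex n"
      interpret K: prob_space "gibbs_kernel_pow n (t n) x"
        by (rule prob_space_gibbs_kernel_pow[OF elim x])
      have "?D n x A \<le> 1"
        using K.prob_le_1[of A] U.prob_le_1[of A] measure_nonneg[of "gibbs_kernel_pow n (t n) x" A]
          measure_nonneg[of "simplex_uniform n" A] by linarith
      then show "ereal (?D n x A) \<le> 1" by simp
    qed
  qed
  have "(\<lambda>n. real n powr (- 2 * C\<^sup>2)) \<longlonglongrightarrow> 0"
    using C by (intro tendsto_neg_powr filterlim_real_sequentially) simp
  then have "(\<lambda>n. 1 - real n powr (- 2 * C\<^sup>2)) \<longlonglongrightarrow> 1 - 0"
    by (intro tendsto_diff tendsto_const)
  then have "(\<lambda>n. ereal (1 - real n powr (- 2 * C\<^sup>2))) \<longlonglongrightarrow> 1"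
    by (simp add: one_ereal_def)
  then have "?S \<longlonglongrightarrow> 1"
    by (rule tendsto_sandwich[OF lower upper _ tendsto_const])
  then show "liminf ?S = 1"
    by (intro lim_imp_Liminf) simp_all
qed

end
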